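(* Let $\theta\in(0,1)$, $tol\in[0,1)$ and set $\rho=\rho(\theta)=\sqrt{1-\frac{\alpha_*}{\alpha^*}\theta^2}\in(0,1)$. Let $\{\Lambda_n,u_n\}_{n\ge0}$ be the sequence generated by the algorithm ADFOUR$(\theta,tol)$. Then for every $n$ $$|||u-u_{n+1}|||\le\rho\,|||u-u_n|||.$$ Thus, for any $tol>0$ the algorithm terminates in a finite number of iterations, whereas for $tol=0$ the sequence $u_n$ converges to $u$ in $H^1_p(\Omega)$ as $n\to\infty$.
   Context: Let $d\ge1$, $\Omega=(0,2\pi)^d$, $\phi_k(x)=(2\pi)^{-d/2}e^{ik\cdot x}$ for $k\in\mathbb Z^d$, and $\hat v_k=(v,\phi_k)_{L^2(\Omega)}$. $V=H^1_p(\Omega)$ is the space of $H^1$ functions $2\pi$-periodic in each direction, with norm $\|v\|^2=\sum_k(1+|k|^2)|\hat v_k|^2$ ($|k|$ Euclidean norm). $H^{-1}_p(\Omega)$ is its (anti)dual; for $f\in H^{-1}_p(\Omega)$, $\hat f_k=\langle f,\phi_k\rangle$ and $\|f\|^2=\sum_k(1+|k|^2)^{-1}|\hat f_k|^2$ (the same symbol $\|\cdot\|$ is used for both norms). For $\Lambda\subset\mathbb Z^d$, $P_\Lambda$ keeps only the Fourier coefficients with index in $\Lambda$, and $V_\Lambda=\mathrm{span}\{\phi_k:k\in\Lambda\}$. Let $Lu=-\nabla\cdot(\nu\nabla u)+\sigma u$ with sufficiently smooth real ($2\pi$-periodic) coefficients, $0<\nu_*\le\nu\le\nu^*<\infty$,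 $0<\sigma_*\le\sigma\le\sigma^*<\infty$; $\alpha_*=\min(\nu_*,\sigma_* )$, $\alpha^*=\max(\nu^*,\sigma^* )$. Let $a(u,v)=\int_\Omega\nu\nabla u\cdot\nabla\bar v+\int_\Omega\sigma u\bar v$, $|||v|||=\sqrt{a(v,v)}$, $f\in H^{-1}_p(\Omega)$, and let $u\in V$ be the solution of $a(u,v)=\langle f,v\rangle$ for all $v\in V$. For finite $\Lambda$, the Galerkin solution $u_\Lambda\in V_\Lambda$ satisfies $a(u_\Lambda,v)=\langle f,v\rangle$ for all $v\in V_\Lambda$ ($u_\emptyset=0$). The residual is $r(w)=f-Lw$. Procedure DÖRFLER$(r,\theta)$: returns a finite set $\Lambda^*\subset\mathbb Z^d$ of minimal cardinality among those with $\|P_{\Lambda^*}r\|\ge\theta\|r\|$. Algorithm ADFOUR$(\theta,tol)$: set $\Lambda_0=\emptyset$, $u_0=0$, $r_0=f$. For $n=0,1,2,\dots$: $\partial\Lambda_n=$ DÖRFLER$(r_n,\theta)$; $\Lambda_{n+1}=\Lambda_n\cup\partial\Lambda_n$; $u_{n+1}=u_{\Lambda_{n+1}}$ (Galerkin solution); $r_{n+1}=r(u_{n+1})$; continue while $\|r_{n+1}\|>tol$. *)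

theory Defs
  imports "HOL-Analysis.Analysis" "HOL-Library.Extended_Nat"
begin

definition Omega :: "(real^'d) set" where
  "Omega = {x. \<forall>j. 0 < x $ j \<and> x $ j < 2 * pi}"

definition periodic :: "(real^'d \<Rightarrow> 'b) \<Rightarrow> bool" where
  "periodic v \<longleftrightarrow> (\<forall>x j. v (x + axis j (2 * pi)) = v x)"

definition partial_deriv :: "'d \<Rightarrow> (real^'d \<Rightarrow> 'b::real_normed_vector) \<Rightarrow> real^'d \<Rightarrow> 'b" where
  "partial_deriv j v x = frechet_derivative v (at x) (axis j 1)"

definition C1 :: "(real^'d \<Rightarrow> 'b::real_normed_vector) \<Rightarrow> bool" where
  "C1 v \<longleftrightarrow> (\<forall>x. v differentiable (at x)) \<and> (\<forall>j. continuous_on UNIV (partial_deriv j v))"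

definition L2 :: "(real^'d \<Rightarrow> 'b::euclidean_space) \<Rightarrow> bool" where
  "L2 v \<longleftrightarrow> v \<in> borel_measurable (lebesgue_on Omega)
          \<and> integrable (lebesgue_on Omega) (\<lambda>x. (norm (v x))\<^sup>2)"

text \<open>Wave vectors are elements of \<open>int^'d\<close>; \<open>wave k\<close> is the same vector in \<open>real^'d\<close>, so that
  \<open>wave k \<bullet> x\<close> is $k \cdot x$ and \<open>norm (wave k)\<close> is the Euclidean norm $|k|$.\<close>

definition wave :: "int^'d \<Rightarrow> real^'d" where
  "wave k = (\<chi> j. real_of_int (k $ j))"

definition phi :: "int^'d \<Rightarrow> real^'d \<Rightarrow> complex" where
  "phi k x = of_real ((2 * pi) powr (- (real CARD('d) / 2))) * exp (\<i> * of_real (wave k \<bullet> x))"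

definition fourier_coeff :: "(real^'d \<Rightarrow> complex) \<Rightarrow> int^'d \<Rightarrow> complex" where
  "fourier_coeff v k = (\<integral>x. v x * cnj (phi k x) \<partial>lebesgue_on Omega)"

text \<open>Weak gradient on the torus: the test functions are periodic and need not vanish on the
  boundary of \<open>Omega\<close>, so that a periodic function with traces jumping across opposite faces of
  the cube has no weak gradient. By mollification, \<open>C1\<close> test functions give the same notion as
  smooth ones.\<close>

definition has_weak_gradient :: "(real^'d \<Rightarrow> complex) \<Rightarrow> (real^'d \<Rightarrow> complex^'d) \<Rightarrow> bool" where
  "has_weak_gradient v g \<longleftrightarrow> L2 g \<and>
     (\<forall>\<psi> :: real^'d \<Rightarrow> complex. periodic \<psi> \<and> C1 \<psi> \<longrightarrow>
        (\<forall>j. (\<integral>x. v x * partial_deriv j \<psi> x \<partial>lebesgue_on Omega)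
           = - (\<integral>x. g x $ j * \<psi> x \<partial>lebesgue_on Omega)))"

text \<open>The elements of $H^1_p(\Omega)$ are represented by functions, not by classes modulo
  null sets. Accordingly the weak gradient is determined only almost everywhere; it is used only
  under integrals.\<close>

definition H1p :: "(real^'d \<Rightarrow> complex) set" where
  "H1p = {v. periodic v \<and> L2 v \<and> (\<exists>g. has_weak_gradient v g)}"

definition grad :: "(real^'d \<Rightarrow> complex) \<Rightarrow> real^'d \<Rightarrow> complex^'d" where
  "grad v = (SOME g. has_weak_gradient v g)"

definition norm_H1p :: "(real^'d \<Rightarrow> complex) \<Rightarrow> real" where
  "norm_H1p v = sqrt (\<Sum>\<^sub>\<infinity>k. (1 + (norm (wave k))\<^sup>2) * (cmod (fourier_coeff v k))\<^sup>2)"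

definition tendsto_H1p :: "(nat \<Rightarrow> real^'d \<Rightarrow> complex) \<Rightarrow> (real^'d \<Rightarrow> complex) \<Rightarrow> bool" where
  "tendsto_H1p w u \<longleftrightarrow> (\<forall>n. w n \<in> H1p) \<and> u \<in> H1p
      \<and> (\<lambda>n. norm_H1p (\<lambda>x. u x - w n x)) \<longlonglongrightarrow> 0"

text \<open>A functional \<open>f\<close> acts on functions; only its values on \<open>H1p\<close> are relevant. Boundedness
  forces \<open>f\<close> to agree on functions that are equal almost everywhere.\<close>

type_synonym 'd functional = "(real^'d \<Rightarrow> complex) \<Rightarrow> complex"

definition Hm1p :: "'d::finite functional set" where
  "Hm1p = {f. (\<forall>v\<in>H1p. \<forall>w\<in>H1p. f (\<lambda>x. v x + w x) = f v + f w)
            \<and> (\<forall>c. \<forall>v\<in>H1p. f (\<lambda>x. c * v x) = cnj c * f v)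
            \<and> (\<exists>C. \<forall>v\<in>H1p. cmod (f v) \<le> C * norm_H1p v)}"

definition dual_coeff :: "'d::finite functional \<Rightarrow> int^'d \<Rightarrow> complex" where
  "dual_coeff f k = f (phi k)"

definition norm_Hm1p :: "'d::finite functional \<Rightarrow> real" where
  "norm_Hm1p f = sqrt (\<Sum>\<^sub>\<infinity>k. (cmod (dual_coeff f k))\<^sup>2 / (1 + (norm (wave k))\<^sup>2))"

text \<open>The functional $\sum_{k \in \Lambda} \hat f_k \phi_k$, where $\langle \phi_k, v \rangle$
  is the complex conjugate of $\hat v_k$.\<close>

definition proj :: "(int^'d) set \<Rightarrow> 'd::finite functional \<Rightarrow> 'd functional" where
  "proj \<Lambda> f = (\<lambda>v. \<Sum>\<^sub>\<infinity>k\<in>\<Lambda>. dual_coeff f k * cnj (fourier_coeff v k))"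

definition V_sub :: "(int^'d) set \<Rightarrow> (real^'d \<Rightarrow> complex) set" where
  "V_sub \<Lambda> = {(\<lambda>x. \<Sum>k\<in>F. c k * phi k x) | F c. finite F \<and> F \<subseteq> \<Lambda>}"

definition bform :: "(real^'d \<Rightarrow> real) \<Rightarrow> (real^'d \<Rightarrow> real) \<Rightarrow>
    (real^'d \<Rightarrow> complex) \<Rightarrow> (real^'d \<Rightarrow> complex) \<Rightarrow> complex" where
  "bform \<nu> \<sigma> u v =
     (\<integral>x. of_real (\<nu> x) * (\<Sum>j\<in>UNIV. grad u x $ j * cnj (grad v x $ j)) \<partial>lebesgue_on Omega)
   + (\<integral>x. of_real (\<sigma> x) * u x * cnj (v x) \<partial>lebesgue_on Omega)"

definition energy_norm :: "(real^'d \<Rightarrow> real) \<Rightarrow> (real^'d \<Rightarrow> real) \<Rightarrow> (real^'d \<Rightarrow> complex) \<Rightarrow> real" where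
  "energy_norm \<nu> \<sigma> v = sqrt (Re (bform \<nu> \<sigma> v v))"

text \<open>$L w = -\nabla\cdot(\nu\nabla w) + \sigma w$ is an element of $H^{-1}_p(\Omega)$, the
  divergence being taken in the weak sense.\<close>

definition L_op :: "(real^'d \<Rightarrow> real) \<Rightarrow> (real^'d \<Rightarrow> real) \<Rightarrow>
    (real^'d \<Rightarrow> complex) \<Rightarrow> 'd::finite functional" where
  "L_op \<nu> \<sigma> w = (\<lambda>v. bform \<nu> \<sigma> w v)"

definition residual :: "(real^'d \<Rightarrow> real) \<Rightarrow> (real^'d \<Rightarrow> real) \<Rightarrow> 'd::finite functional \<Rightarrow>
    (real^'d \<Rightarrow> complex) \<Rightarrow> 'd functional" where
  "residual \<nu> \<sigma> f w = (\<lambda>v. f v - L_op \<nu> \<sigma> w v)"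

definition is_solution :: "(real^'d \<Rightarrow> real) \<Rightarrow> (real^'d \<Rightarrow> real) \<Rightarrow> 'd::finite functional \<Rightarrow>
    (real^'d \<Rightarrow> complex) \<Rightarrow> bool" where
  "is_solution \<nu> \<sigma> f u \<longleftrightarrow> u \<in> H1p \<and> (\<forall>v\<in>H1p. bform \<nu> \<sigma> u v = f v)"

definition galerkin :: "(real^'d \<Rightarrow> real) \<Rightarrow> (real^'d \<Rightarrow> real) \<Rightarrow> 'd::finite functional \<Rightarrow>
    (int^'d) set \<Rightarrow> (real^'d \<Rightarrow> complex)" where
  "galerkin \<nu> \<sigma> f \<Lambda> = (THE w. w \<in> V_sub \<Lambda> \<and> (\<forall>v\<in>V_sub \<Lambda>. bform \<nu> \<sigma> w v = f v))"

definition is_doerfler_set :: "'d::finite functional \<Rightarrow> real \<Rightarrow> (int^'d) set \<Rightarrow> bool" where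
  "is_doerfler_set r \<theta> \<Lambda> \<longleftrightarrow>
     finite \<Lambda> \<and> norm_Hm1p (proj \<Lambda> r) \<ge> \<theta> * norm_Hm1p r
   \<and> (\<forall>\<Lambda>'. finite \<Lambda>' \<and> norm_Hm1p (proj \<Lambda>' r) \<ge> \<theta> * norm_Hm1p r \<longrightarrow> card \<Lambda> \<le> card \<Lambda>')"

text \<open>The minimal sets are not unique: a Doerfler procedure is any function that returns one.\<close>

type_synonym 'd doerfler = "'d functional \<Rightarrow> real \<Rightarrow> (int^'d) set"

definition doerfler_procedure :: "'d::finite doerfler \<Rightarrow> bool" where
  "doerfler_procedure D \<longleftrightarrow>
     (\<forall>r \<theta>. r \<in> Hm1p \<and> 0 < \<theta> \<and> \<theta> < 1 \<longrightarrow> is_doerfler_set r \<theta> (D r \<theta>))"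

text \<open>The triples $(\Lambda_n, u_n, r_n)$ computed by the loop body, before the stopping test
  is taken into account.\<close>

primrec adfour_iter :: "'d::finite doerfler \<Rightarrow> (real^'d \<Rightarrow> real) \<Rightarrow> (real^'d \<Rightarrow> real) \<Rightarrow>
    'd functional \<Rightarrow> real \<Rightarrow> nat \<Rightarrow> (int^'d) set \<times> (real^'d \<Rightarrow> complex) \<times> 'd functional" where
  "adfour_iter D \<nu> \<sigma> f \<theta> 0 = ({}, (\<lambda>x. 0), f)"
| "adfour_iter D \<nu> \<sigma> f \<theta> (Suc n) =
     (case adfour_iter D \<nu> \<sigma> f \<theta> n of (\<Lambda>, u, r) \<Rightarrow>
        let \<Lambda>' = \<Lambda> \<union> D r \<theta>; u' = galerkin \<nu> \<sigma> f \<Lambda>'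
        in (\<Lambda>', u', residual \<nu> \<sigma> f u'))"

text \<open>The number of executions of the loop body: the least $n + 1$ with $\|r_{n+1}\| \le tol$, and
  \<open>\<infinity>\<close> (the infimum of the empty set) if the algorithm does not terminate.\<close>

definition adfour_steps :: "'d::finite doerfler \<Rightarrow> (real^'d \<Rightarrow> real) \<Rightarrow> (real^'d \<Rightarrow> real) \<Rightarrow>
    'd functional \<Rightarrow> real \<Rightarrow> real \<Rightarrow> enat" where
  "adfour_steps D \<nu> \<sigma> f \<theta> tol =
     Inf {enat (Suc n) | n. norm_Hm1p (snd (snd (adfour_iter D \<nu> \<sigma> f \<theta> (Suc n)))) \<le> tol}"

text \<open>The generated sequence $u_n$; if the algorithm stops after $N$ iterations, the sequence is
  continued by the constant value $u_N$.\<close>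

definition adfour_u :: "'d::finite doerfler \<Rightarrow> (real^'d \<Rightarrow> real) \<Rightarrow> (real^'d \<Rightarrow> real) \<Rightarrow>
    'd functional \<Rightarrow> real \<Rightarrow> real \<Rightarrow> nat \<Rightarrow> real^'d \<Rightarrow> complex" where
  "adfour_u D \<nu> \<sigma> f \<theta> tol n =
     fst (snd (adfour_iter D \<nu> \<sigma> f \<theta>
       (the_enat (min (enat n) (adfour_steps D \<nu> \<sigma> f \<theta> tol)))))"

end

theory Submission
  imports Defs
begin

text \<open>
  Write $e_n = u - u_n$ and $d_n = u_{n+1} - u_n$. Galerkin orthogonality of $e_{n+1}$ to
  $V_{\Lambda_{n+1}}$, which contains $d_n$, gives $|||e_n|||^2 = |||e_{n+1}|||^2 + |||d_n|||^2$.
  So the contraction follows once $d_n$ is known to carry a fixed fraction of the energy of $e_n$.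
  Two estimates that compare energy and residual provide this.

  First, $\|P_F Lw\|^2 \le \alpha^* |||w|||^2$ for $w$ in $H^1_p$ and finite $F$ (\<open>dual_sum_le_energy\<close>). Applied to
  $w = d_n$ and $F = \partial\Lambda_n$, where $L d_n$ and $r_n$ have the same coefficients, it gives
  $\alpha^* |||d_n|||^2 \ge \|P_{\partial\Lambda_n} r_n\|^2 \ge \theta^2 \|r_n\|^2$. Second,
  $\|r_n\|^2 \ge \alpha_* |||e_n|||^2$ (\<open>energy_le_residual\<close>). Together they yield
  $|||d_n|||^2 \ge \frac{\alpha_*}{\alpha^*} \theta^2 |||e_n|||^2$; this is \<open>galerkin_step_contraction\<close>.
  Since the first estimate also bounds $\|r_n\|$ by the energy norm of the error, the residuals tend
  to zero and the stopping test succeeds for every positive tolerance. The $H^1$ norm is bounded by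
  the energy norm, so $u_n$ converges to $u$.

  The norms are sums over Fourier coefficients, whereas the form is an integral over weak
  gradients. Coercivity needs only the Bessel inequality, and continuity is needed only on trigonometric
  polynomials, where orthonormality suffices. The Fourier basis has to be complete for two further
  facts: weak gradients are unique almost everywhere (\<open>has_weak_gradient_unique\<close>), which makes the form
  sesquilinear, and $a(w, \cdot)$ is bounded in the Fourier norm for each trigonometric polynomial $w$
  (\<open>bform_phi_bounded\<close>), which puts the residuals into $H^{-1}_p$. Both rest on uniform approximation
  by trigonometric polynomials (\<open>trig_approx_cube\<close>), obtained from the Stone--Weierstrass theorem on
  the torus embedded in $\mathbb C^d$. The same approximation yields integration by parts: it shows
  that the mean of a periodic function is invariant under translation.
\<close>

section \<open>Square-integrable functions on the cube\<close>

lemma Omega_box: "(Omega :: (real^'d) set) = box 0 (\<chi> j. 2 * pi)"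
  by (auto simp: Omega_def mem_box_cart)

lemma Omega_lmeasurable [simp]: "(Omega :: (real^'d) set) \<in> lmeasurable"
  by (simp add: Omega_box)

lemma Omega_sets_lebesgue [simp]: "(Omega :: (real^'d) set) \<in> sets lebesgue"
  using Omega_lmeasurable by (rule fmeasurableD)

lemma finite_measure_Omega: "finite_measure (lebesgue_on (Omega :: (real^'d) set))"
  by (rule finite_measure_lebesgue_on) simp

lemma integrable_const_Omega [simp]:
  "integrable (lebesgue_on (Omega :: (real^'d) set)) (\<lambda>x. c :: 'b::{banach,second_countable_topology})"
  by (rule finite_measure.integrable_const[OF finite_measure_Omega])

lemma continuous_measurable_Omega:
  fixes f :: "real^'d \<Rightarrow> 'b::euclidean_space"
  assumes "continuous_on UNIV f"
  shows "f \<in> borel_measurable (lebesgue_on Omega)"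
  by (rule continuous_imp_measurable_on_sets_lebesgue[OF continuous_on_subset[OF assms]]) auto

lemma continuous_bounded_Omega:
  fixes f :: "real^'d \<Rightarrow> 'b::real_normed_vector"
  assumes "continuous_on UNIV f"
  obtains B where "0 \<le> B" "\<And>x. x \<in> cbox 0 (\<chi> j. 2 * pi) \<Longrightarrow> norm (f x) \<le> B"
proof -
  have "compact (f ` cbox 0 (\<chi> j. 2 * pi))"
    using assms by (intro compact_continuous_image) (auto intro: continuous_on_subset)
  then obtain B where B: "\<forall>y \<in> f ` cbox 0 (\<chi> j. 2 * pi). norm y \<le> B"
    using compact_imp_bounded bounded_iff by metis
  show thesis
    by (rule that[of "max B 0"]) (use B in \<open>auto simp: le_max_iff_disj\<close>)
qed

lemma Omega_subset_cube: "(Omega :: (real^'d) set) \<subseteq> cbox 0 (\<chi> j. 2 * pi)"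
  by (auto simp: Omega_def mem_box_cart less_imp_le)

lemma integrable_bounded_Omega:
  fixes f :: "real^'d \<Rightarrow> 'b::{banach,second_countable_topology}"
  assumes "f \<in> borel_measurable (lebesgue_on Omega)" "\<And>x. x \<in> Omega \<Longrightarrow> norm (f x) \<le> B"
  shows "integrable (lebesgue_on Omega) f"
  by (rule finite_measure.integrable_const_bound[OF finite_measure_Omega, where B = B])
     (use assms in \<open>auto intro!: AE_I2\<close>)

lemma integrable_continuous_Omega:
  fixes f :: "real^'d \<Rightarrow> 'b::euclidean_space"
  assumes "continuous_on UNIV f"
  shows "integrable (lebesgue_on Omega) f"
proof -
  obtain B where "\<And>x. x \<in> cbox 0 (\<chi> j. 2 * pi) \<Longrightarrow> norm (f x) \<le> B"
    using continuous_bounded_Omega[OF assms] by metis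
  then show ?thesis
    using continuous_measurable_Omega[OF assms] Omega_subset_cube
    by (intro integrable_bounded_Omega[where B = B]) auto
qed

lemma L2_bounded_mult:
  fixes f g :: "real^'d \<Rightarrow> complex"
  assumes f: "f \<in> borel_measurable (lebesgue_on Omega)" "\<And>x. x \<in> Omega \<Longrightarrow> cmod (f x) \<le> B"
    and g: "L2 g"
  shows "L2 (\<lambda>x. f x * g x)"
proof -
  have [measurable]: "g \<in> borel_measurable (lebesgue_on Omega)" "f \<in> borel_measurable (lebesgue_on Omega)"
    using f g by (auto simp: L2_def)
  have int: "integrable (lebesgue_on Omega) (\<lambda>x. B\<^sup>2 * (norm (g x))\<^sup>2)"
    using g by (simp add: L2_def)
  have "integrable (lebesgue_on Omega) (\<lambda>x. (norm (f x * g x))\<^sup>2)"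
    by (rule Bochner_Integration.integrable_bound[OF int])
       (use f in \<open>auto intro!: AE_I2 mult_right_mono power_mono simp: norm_mult power_mult_distrib\<close>)
  then show ?thesis by (simp add: L2_def)
qed

lemma L2_continuous:
  fixes f :: "real^'d \<Rightarrow> 'b::euclidean_space"
  assumes "continuous_on UNIV f"
  shows "L2 f"
  unfolding L2_def
  by (intro conjI continuous_measurable_Omega assms integrable_continuous_Omega continuous_intros)

lemma L2_scale:
  fixes f :: "real^'d \<Rightarrow> complex"
  shows "L2 f \<Longrightarrow> L2 (\<lambda>x. c * f x)"
  by (rule L2_bounded_mult[where B = "cmod c"]) auto

lemma L2_cnj: "L2 f \<Longrightarrow> L2 (\<lambda>x. cnj (f x))"
  using measurable_compose[OF _ borel_measurable_continuous_onI[of cnj]]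
  by (auto simp: L2_def continuous_on_cnj)

text \<open>The elementary bound $ab \le a^2 + b^2$ replaces the Cauchy--Schwarz inequality here, since
  only integrability is asked for.\<close>

lemma L2_integrable_mult:
  fixes f g :: "real^'d \<Rightarrow> complex"
  assumes f: "L2 f" and g: "L2 g"
  shows "integrable (lebesgue_on Omega) (\<lambda>x. f x * g x)"
proof -
  have [measurable]: "g \<in> borel_measurable (lebesgue_on Omega)" "f \<in> borel_measurable (lebesgue_on Omega)"
    using f g by (auto simp: L2_def)
  have int: "integrable (lebesgue_on Omega) (\<lambda>x. (norm (f x))\<^sup>2 + (norm (g x))\<^sup>2)"
    using f g by (simp add: L2_def)
  have bd: "a * b \<le> a\<^sup>2 + b\<^sup>2" if "0 \<le> a" "0 \<le> b" for a b :: real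
    using that sum_squares_bound[of a b] mult_nonneg_nonneg[OF that] by linarith
  show ?thesis
    by (rule Bochner_Integration.integrable_bound[OF int]) (auto simp: norm_mult bd)
qed

lemma integrable_weighted:
  fixes v w :: "real^'d \<Rightarrow> complex"
  assumes "continuous_on UNIV c" "L2 v" "L2 w"
  shows "integrable (lebesgue_on Omega) (\<lambda>x. of_real (c x) * v x * cnj (w x))"
proof -
  obtain B where B: "\<And>x. x \<in> cbox 0 (\<chi> j. 2 * pi) \<Longrightarrow> norm (c x) \<le> B"
    using continuous_bounded_Omega[OF assms(1)] by metis
  have "continuous_on UNIV (\<lambda>x. complex_of_real (c x))"
    by (intro continuous_intros assms)
  then have "L2 (\<lambda>x. complex_of_real (c x) * v x)"
    using B Omega_subset_cube
    by (intro L2_bounded_mult[where B = B] continuous_measurable_Omega assms) auto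
  then show ?thesis by (intro L2_integrable_mult L2_cnj assms)
qed

lemma L2_add:
  fixes f g :: "real^'d \<Rightarrow> 'b::euclidean_space"
  assumes f: "L2 f" and g: "L2 g"
  shows "L2 (\<lambda>x. f x + g x)"
proof -
  have [measurable]: "g \<in> borel_measurable (lebesgue_on Omega)" "f \<in> borel_measurable (lebesgue_on Omega)"
    using f g by (auto simp: L2_def)
  have int: "integrable (lebesgue_on Omega) (\<lambda>x. 2 * (norm (f x))\<^sup>2 + 2 * (norm (g x))\<^sup>2)"
    using f g by (simp add: L2_def)
  have bd: "(norm (f x + g x))\<^sup>2 \<le> 2 * (norm (f x))\<^sup>2 + 2 * (norm (g x))\<^sup>2" for x
  proof -
    have "(norm (f x + g x))\<^sup>2 \<le> (norm (f x) + norm (g x))\<^sup>2"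
      by (intro power_mono norm_triangle_ineq) auto
    also have "\<dots> \<le> 2 * (norm (f x))\<^sup>2 + 2 * (norm (g x))\<^sup>2"
      using sum_squares_bound[of "norm (f x)" "norm (g x)"] by (simp add: power2_sum)
    finally show ?thesis .
  qed
  have "integrable (lebesgue_on Omega) (\<lambda>x. (norm (f x + g x))\<^sup>2)"
    by (rule Bochner_Integration.integrable_bound[OF int]) (auto simp: bd)
  then show ?thesis by (simp add: L2_def)
qed

lemma L2_integrable:
  fixes f :: "real^'d \<Rightarrow> complex"
  assumes "L2 f"
  shows "integrable (lebesgue_on Omega) f"
  using L2_integrable_mult[OF L2_continuous[of "\<lambda>x. 1"] assms] by simp

lemma borel_measurable_vec_nth_comp:
  fixes g :: "'a \<Rightarrow> complex^'d"
  assumes "g \<in> borel_measurable M"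
  shows "(\<lambda>x. g x $ j) \<in> borel_measurable M"
  by (rule measurable_compose[OF assms]) (intro borel_measurable_continuous_onI continuous_intros)

lemma L2_vec_nth:
  fixes g :: "real^'d \<Rightarrow> complex^'d"
  assumes "L2 g"
  shows "L2 (\<lambda>x. g x $ j)"
proof -
  have m: "g \<in> borel_measurable (lebesgue_on Omega)" using assms by (simp add: L2_def)
  note [measurable] = borel_measurable_vec_nth_comp[OF m]
  have int: "integrable (lebesgue_on Omega) (\<lambda>x. (norm (g x))\<^sup>2)"
    using assms by (simp add: L2_def)
  have "integrable (lebesgue_on Omega) (\<lambda>x. (norm (g x $ j))\<^sup>2)"
    by (rule Bochner_Integration.integrable_bound[OF int])
       (auto intro!: AE_I2 power_mono Finite_Cartesian_Product.norm_nth_le)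
  then show ?thesis by (simp add: L2_def)
qed

lemma L2_vec_scale:
  fixes g :: "real^'d \<Rightarrow> complex^'d"
  assumes "L2 g"
  shows "L2 (\<lambda>x. c *s g x)"
proof -
  have m [measurable]: "g \<in> borel_measurable (lebesgue_on Omega)" using assms by (simp add: L2_def)
  have cont: "continuous_on UNIV (\<lambda>y::complex^'d. c *s y)"
    unfolding vector_scalar_mult_def by (intro continuous_intros)
  have [measurable]: "(\<lambda>x. c *s g x) \<in> borel_measurable (lebesgue_on Omega)"
    by (rule measurable_compose[OF m borel_measurable_continuous_onI[OF cont]])
  have n: "norm (c *s y) = cmod c * norm y" for y :: "complex^'d"
    by (simp add: norm_vec_def norm_mult L2_set_right_distrib)
  show ?thesis using assms by (simp add: L2_def n power_mult_distrib)
qed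

section \<open>Orthonormality of the Fourier basis\<close>

text \<open>Lebesgue measure on \<open>real^'d\<close> is the image of a product of one-dimensional Lebesgue measures,
  indexed by the standard basis; the indices \<open>j\<close> and the basis vectors \<open>axis j 1\<close> are identified.\<close>

lemma integral_prod_vec_nth:
  fixes f :: "'d::finite \<Rightarrow> real \<Rightarrow> complex"
  assumes "\<And>j. integrable lborel (f j)"
  shows "(\<integral>x. (\<Prod>j\<in>UNIV. f j (x $ j)) \<partial>(lborel :: (real^'d) measure)) = (\<Prod>j\<in>UNIV. \<integral>t. f j t \<partial>lborel)"
proof -
  let ?e = "\<lambda>j::'d. axis j (1::real)"
  have inj: "inj ?e" by (auto simp: inj_on_def axis_eq_axis)
  have B: "Basis = range ?e" by (auto simp: Basis_vec_def)
  define h where "h b = f (inv ?e b)" for b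
  have h: "h (?e j) = f j" for j unfolding h_def using inj by (subst inv_f_f) auto
  have hi: "integrable lborel (h b)" for b using assms by (simp add: h_def)
  have [measurable]: "h b \<in> borel_measurable borel" for b
    using hi[of b] by (auto dest: borel_measurable_integrable)
  interpret product_sigma_finite "\<lambda>_::real^'d. lborel :: real measure"
    by standard
  have "(\<integral>x. (\<Prod>j\<in>UNIV. f j (x $ j)) \<partial>(lborel :: (real^'d) measure))
      = (\<integral>x. (\<Prod>b\<in>Basis. h b (x \<bullet> b)) \<partial>(lborel :: (real^'d) measure))"
    by (simp add: B prod.reindex[OF inj] h cart_eq_inner_axis)
  also have "\<dots> = (\<Prod>b\<in>Basis. \<integral>t. h b t \<partial>lborel)"
    apply (subst lborel_def)
    apply (subst integral_distr)
      apply (simp_all add: lborel_eq_real[symmetric])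
    apply (subst product_integral_prod[symmetric])
    using hi apply simp_all
    done
  also have "\<dots> = (\<Prod>j\<in>UNIV. \<integral>t. f j t \<partial>lborel)"
    by (simp add: B prod.reindex[OF inj] h)
  finally show ?thesis .
qed

lemma integral_exp_period:
  fixes m :: int
  defines "g \<equiv> \<lambda>t::real. indicator {0<..<2 * pi} t *\<^sub>R (exp (\<i> * of_real (of_int m * t)) / (2 * pi))"
  shows "integrable lborel g" "integral\<^sup>L lborel g = (if m = 0 then 1 else 0)"
proof -
  let ?f = "\<lambda>t::real. exp (\<i> * of_real (of_int m * t)) / (2 * pi)"
  have int: "set_integrable lborel {0..2 * pi} ?f"
    by (rule borel_integrable_atLeastAtMost') (auto intro!: continuous_intros)
  show i: "integrable lborel g"
    using set_integrable_subset[OF int, of "{0<..<2 * pi}"]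
    by (simp add: set_integrable_def g_def greaterThanLessThan_subseteq_atLeastAtMost_iff)
  have ae: "AE t in lborel. g t = indicator {0..2 * pi} t *\<^sub>R ?f t"
    using AE_lborel_singleton[of 0] AE_lborel_singleton[of "2 * pi"]
    by eventually_elim (auto simp: g_def indicator_def)
  have "integral\<^sup>L lborel g = (\<integral>t. indicator {0..2 * pi} t *\<^sub>R ?f t \<partial>lborel)"
    using i int ae by (intro integral_cong_AE) (auto simp: set_integrable_def)
  also have "\<dots> = (if m = 0 then 1 else 0)"
  proof (cases "m = 0")
    case True
    then show ?thesis by (simp add: scaleR_conv_of_real)
  next
    case False
    let ?F = "\<lambda>t::real. exp (\<i> * of_real (of_int m * t)) / (\<i> * of_int m * (2 * pi))"
    have "(\<integral>t. indicator {0..2 * pi} t *\<^sub>R ?f t \<partial>lborel) = ?F (2 * pi) - ?F 0"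
      apply (rule integral_FTC_Icc)
      subgoal by simp
      subgoal for t
      proof -
        have "((\<lambda>z. exp (\<i> * (of_int m * z)) / (\<i> * of_int m * (2 * pi))) has_field_derivative
            exp (\<i> * (of_int m * of_real t)) / (2 * pi)) (at (of_real t))"
          using False by (auto intro!: derivative_eq_intros)
        from has_vector_derivative_real_field[OF this] show ?thesis by simp
      qed
      subgoal by (auto intro!: continuous_intros)
      done
    also have "exp (\<i> * of_real (of_int m * (2 * pi))) = 1"
      using exp_two_pi_i exp_integer_2pi[of "of_int m"] by (simp add: mult_ac)
    finally show ?thesis using False by simp
  qed
  finally show "integral\<^sup>L lborel g = (if m = 0 then 1 else 0)" .
qed

lemma continuous_phi: "continuous_on UNIV (phi k)"
  unfolding phi_def by (intro continuous_intros)

text \<open>The product of two basis functions splits into one-variable factors, one for each coordinate,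
  with the normalizing constant shared out evenly. This is what reduces orthonormality to the
  one-dimensional integral of an exponential over a period.\<close>

lemma phi_mult_cnj_phi:
  fixes k l :: "int^'d"
  shows "phi k x * cnj (phi l x) = (\<Prod>j\<in>UNIV. exp (\<i> * of_real (of_int (k $ j - l $ j) * x $ j)) / (2 * pi))"
proof -
  have c: "((2 * pi) powr (- (real CARD('d) / 2)))\<^sup>2 = 1 / (2 * pi) ^ CARD('d)"
    by (simp add: power2_eq_square powr_add[symmetric] powr_minus powr_realpow field_simps)
  have "exp (\<i> * of_real (wave k \<bullet> x)) * cnj (exp (\<i> * of_real (wave l \<bullet> x)))
      = exp (\<Sum>j\<in>UNIV. \<i> * of_real (of_int (k $ j - l $ j) * x $ j))"
    by (simp add: exp_cnj mult_exp_exp inner_vec_def wave_def sum_distrib_left[symmetric] sum_subtractf left_diff_distrib right_diff_distrib)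
  also have "\<dots> = (\<Prod>j\<in>UNIV. exp (\<i> * of_real (of_int (k $ j - l $ j) * x $ j)))"
    by (rule exp_sum) simp
  finally have e: "exp (\<i> * of_real (wave k \<bullet> x)) * cnj (exp (\<i> * of_real (wave l \<bullet> x))) = \<dots>" .
  have "phi k x * cnj (phi l x) = of_real (((2 * pi) powr (- (real CARD('d) / 2)))\<^sup>2) *
      (exp (\<i> * of_real (wave k \<bullet> x)) * cnj (exp (\<i> * of_real (wave l \<bullet> x))))"
    by (simp add: phi_def power2_eq_square)
  also have "\<dots> = (\<Prod>j\<in>UNIV. exp (\<i> * of_real (of_int (k $ j - l $ j) * x $ j)) / (2 * pi))"
    by (subst c) (simp add: e prod_dividef)
  finally show ?thesis .
qed

lemma phi_orthonormal:
  fixes k l :: "int^'d"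
  shows "(\<integral>x. phi k x * cnj (phi l x) \<partial>lebesgue_on Omega) = (if k = l then 1 else 0)"
proof -
  let ?g = "\<lambda>j t::real. indicator {0<..<2 * pi} t *\<^sub>R (exp (\<i> * of_real (of_int (k $ j - l $ j) * t)) / (2 * pi))"
  have ind: "indicator Omega x = (\<Prod>j\<in>UNIV. indicator {0<..<2 * pi} (x $ j) :: real)" for x :: "real^'d"
    by (auto simp: Omega_def indicator_def)
  have e: "indicator Omega x *\<^sub>R (phi k x * cnj (phi l x)) = (\<Prod>j\<in>UNIV. ?g j (x $ j))" for x
    by (simp add: phi_mult_cnj_phi ind scaleR_conv_of_real prod.distrib[symmetric])
  have "(\<integral>x. phi k x * cnj (phi l x) \<partial>lebesgue_on Omega)
      = (\<integral>x. indicator Omega x *\<^sub>R (phi k x * cnj (phi l x)) \<partial>lebesgue)"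
    by (rule integral_restrict_space) simp
  also have "\<dots> = (\<integral>x. indicator Omega x *\<^sub>R (phi k x * cnj (phi l x)) \<partial>lborel)"
  proof (rule integral_completion)
    have [measurable]: "phi m \<in> borel_measurable borel" for m :: "int^'d"
      by (rule borel_measurable_continuous_onI[OF continuous_phi])
    have [measurable]: "(\<lambda>x. cnj (phi m x)) \<in> borel_measurable borel" for m :: "int^'d"
      by (rule borel_measurable_continuous_onI) (intro continuous_intros continuous_phi)
    have [measurable]: "(Omega :: (real^'d) set) \<in> sets borel" by (simp add: Omega_box)
    show "(\<lambda>x. indicator Omega x *\<^sub>R (phi k x * cnj (phi l x))) \<in> borel_measurable lborel"
      by measurable
  qed
  also have "\<dots> = (\<Prod>j\<in>UNIV. integral\<^sup>L lborel (?g j))"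
    unfolding e by (rule integral_prod_vec_nth) (rule integral_exp_period)
  also have "\<dots> = (\<Prod>j\<in>UNIV. if k $ j = l $ j then 1 else 0)"
    by (intro prod.cong refl) (subst integral_exp_period, simp)
  also have "\<dots> = (if k = l then 1 else 0)"
    by (auto simp: vec_eq_iff)
  finally show ?thesis .
qed

section \<open>Trigonometric polynomials\<close>

lemma V_sub_zero: "(\<lambda>x. 0) \<in> V_sub \<Lambda>"
  unfolding V_sub_def by (rule CollectI, rule exI[of _ "{}"]) simp

lemma V_sub_sumI:
  "finite F \<Longrightarrow> F \<subseteq> \<Lambda> \<Longrightarrow> (\<lambda>x. \<Sum>k\<in>F. c k * phi k x) \<in> V_sub \<Lambda>"
  by (auto simp: V_sub_def)

lemma V_sub_phi: "k \<in> \<Lambda> \<Longrightarrow> phi k \<in> V_sub \<Lambda>"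
  using V_sub_sumI[of "{k}" \<Lambda> "\<lambda>_. 1"] by simp

lemma V_sub_add:
  assumes "v \<in> V_sub \<Lambda>" "w \<in> V_sub \<Lambda>"
  shows "(\<lambda>x. v x + w x) \<in> V_sub \<Lambda>"
proof -
  obtain F c where F: "finite F" "F \<subseteq> \<Lambda>" "v = (\<lambda>x. \<Sum>k\<in>F. c k * phi k x)"
    using assms by (auto simp: V_sub_def)
  obtain G d where G: "finite G" "G \<subseteq> \<Lambda>" "w = (\<lambda>x. \<Sum>k\<in>G. d k * phi k x)"
    using assms by (auto simp: V_sub_def)
  have v: "v x = (\<Sum>k\<in>F \<union> G. (if k \<in> F then c k else 0) * phi k x)" for x
    unfolding F(3) using F G by (intro sum.mono_neutral_cong_left) auto
  have w: "w x = (\<Sum>k\<in>F \<union> G. (if k \<in> G then d k else 0) * phi k x)" for x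
    unfolding G(3) using F G by (intro sum.mono_neutral_cong_left) auto
  have "(\<lambda>x. v x + w x) = (\<lambda>x. \<Sum>k\<in>F \<union> G.
      ((if k \<in> F then c k else 0) + (if k \<in> G then d k else 0)) * phi k x)"
    by (simp only: v w sum.distrib[symmetric] distrib_right)
  then show ?thesis
    using V_sub_sumI[of "F \<union> G" \<Lambda>] F G by simp
qed

lemma V_sub_scale:
  assumes "v \<in> V_sub \<Lambda>"
  shows "(\<lambda>x. c * v x) \<in> V_sub \<Lambda>"
proof -
  obtain F d where F: "finite F" "F \<subseteq> \<Lambda>" "v = (\<lambda>x. \<Sum>k\<in>F. d k * phi k x)"
    using assms by (auto simp: V_sub_def)
  have "(\<lambda>x. c * v x) = (\<lambda>x. \<Sum>k\<in>F. (c * d k) * phi k x)"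
    by (simp add: F sum_distrib_left mult.assoc)
  then show ?thesis using V_sub_sumI[of F \<Lambda>] F by simp
qed

lemma V_sub_diff:
  assumes "v \<in> V_sub \<Lambda>" "w \<in> V_sub \<Lambda>"
  shows "(\<lambda>x. v x - w x) \<in> V_sub \<Lambda>"
  using V_sub_add[OF assms(1) V_sub_scale[OF assms(2), of "-1"]] by simp

lemma V_sub_sum:
  assumes "finite I" "\<And>i. i \<in> I \<Longrightarrow> v i \<in> V_sub \<Lambda>"
  shows "(\<lambda>x. \<Sum>i\<in>I. v i x) \<in> V_sub \<Lambda>"
  using assms by (induction I rule: finite_induct) (auto intro: V_sub_zero V_sub_add)

lemma V_sub_mono: "\<Lambda> \<subseteq> \<Lambda>' \<Longrightarrow> V_sub \<Lambda> \<subseteq> V_sub \<Lambda>'"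
  unfolding V_sub_def by blast

text \<open>Adding one multiple of a basis function at a time avoids explicit coefficient families in most
  arguments about trigonometric polynomials.\<close>

lemma V_sub_induct [consumes 1, case_names zero step]:
  assumes v: "v \<in> V_sub \<Lambda>"
    and zero: "P (\<lambda>x. 0)"
    and step: "\<And>c k v. v \<in> V_sub \<Lambda> \<Longrightarrow> P v \<Longrightarrow> k \<in> \<Lambda> \<Longrightarrow> P (\<lambda>x. c * phi k x + v x)"
  shows "P v"
proof -
  obtain F c where F: "finite F" "F \<subseteq> \<Lambda>" "v = (\<lambda>x. \<Sum>k\<in>F. c k * phi k x)"
    using v by (auto simp: V_sub_def)
  have "P (\<lambda>x. \<Sum>k\<in>F. c k * phi k x)"
    using F(1,2)
  proof (induction F rule: finite_induct)
    case empty
    then show ?case using zero by simp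
  next
    case (insert k F)
    then show ?case using step[OF V_sub_sumI[of F \<Lambda> c]] by simp
  qed
  then show ?thesis by (simp add: F)
qed

text \<open>Enlarging the index set by one frequency adds one dimension; the existence of Galerkin
  solutions is proved by adding frequencies one at a time.\<close>

lemma V_sub_insert:
  assumes "v \<in> V_sub (insert k \<Lambda>)"
  obtains w c where "w \<in> V_sub \<Lambda>" "v = (\<lambda>x. w x + c * phi k x)"
proof -
  have "\<exists>w\<in>V_sub \<Lambda>. \<exists>c. v = (\<lambda>x. w x + c * phi k x)"
    using assms
  proof (induction rule: V_sub_induct)
    case zero
    show ?case by (rule bexI[OF _ V_sub_zero], rule exI[of _ 0]) simp
  next
    case (step d l v)
    then obtain w c where w: "w \<in> V_sub \<Lambda>" "v = (\<lambda>x. w x + c * phi k x)" by blast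
    show ?case
    proof (cases "l = k")
      case True
      show ?thesis
        by (rule bexI[OF _ w(1)], rule exI[of _ "c + d"]) (simp add: w True algebra_simps)
    next
      case False
      then have "l \<in> \<Lambda>" using step.hyps by simp
      then have "(\<lambda>x. d * phi l x + w x) \<in> V_sub \<Lambda>"
        by (intro V_sub_add V_sub_scale V_sub_phi w)
      then show ?thesis
        by (rule bexI[rotated]) (rule exI[of _ c], simp add: w algebra_simps)
    qed
  qed
  then show ?thesis using that by blast
qed

lemma V_sub_continuous: "v \<in> V_sub \<Lambda> \<Longrightarrow> continuous_on UNIV v"
  by (induction rule: V_sub_induct) (intro continuous_intros continuous_phi | assumption)+

lemma wave_add: "wave (k + l) = wave k + wave l"
  by (simp add: wave_def vec_eq_iff)

lemma V_sub_exp: "(\<lambda>x. exp (\<i> * of_real (wave k \<bullet> x))) \<in> V_sub UNIV"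
  using V_sub_scale[OF V_sub_phi[of k UNIV], of "inverse (of_real ((2 * pi) powr (- (real CARD('a) / 2))))"]
  by (simp add: phi_def mult.assoc[symmetric])

lemma V_sub_const: "(\<lambda>x. c) \<in> V_sub UNIV"
  using V_sub_scale[OF V_sub_exp[of 0], of c] by (simp add: wave_def zero_vec_def inner_vec_def)

text \<open>The product of two basis functions is a multiple of a third one, $\phi_{k+l}$. Hence
  trigonometric polynomials form an algebra, which lets polynomials in the coordinates of the
  embedded torus be pulled back to them.\<close>

lemma V_sub_mult:
  assumes "v \<in> V_sub UNIV" "w \<in> V_sub UNIV"
  shows "(\<lambda>x. v x * w x) \<in> V_sub UNIV"
proof -
  have pp: "(\<lambda>x. phi k x * phi l x) \<in> V_sub UNIV" for k l :: "int^'a"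
  proof -
    let ?c = "of_real ((2 * pi) powr (- (real CARD('a) / 2))) :: complex"
    have "(\<lambda>x. phi k x * phi l x) = (\<lambda>x. ?c * phi (k + l) x)"
      by (simp add: fun_eq_iff phi_def wave_add inner_add_left exp_add distrib_left)
    then show ?thesis by (simp add: V_sub_scale V_sub_phi)
  qed
  have p: "(\<lambda>x. phi k x * w x) \<in> V_sub UNIV" for k :: "int^'a"
    using assms(2)
  proof (induction rule: V_sub_induct)
    case zero
    then show ?case by (simp add: V_sub_zero)
  next
    case (step c l v)
    then show ?case
      using V_sub_add[OF V_sub_scale[OF pp[of k l], of c] step.IH]
      by (simp add: algebra_simps)
  qed
  show ?thesis
    using assms(1)
  proof (induction rule: V_sub_induct)
    case zero
    then show ?case by (simp add: V_sub_zero)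
  next
    case (step c l v)
    then show ?case
      using V_sub_add[OF V_sub_scale[OF p[of l], of c] step.IH]
      by (simp add: algebra_simps)
  qed
qed

section \<open>Uniform approximation on the torus\<close>

text \<open>The embedding of the torus into $\mathbb C^d$. It turns uniform approximation of periodic
  functions by trigonometric polynomials into polynomial approximation on a compact set.\<close>

definition torus_map :: "real^'d \<Rightarrow> complex^'d" where
  "torus_map x = (\<chi> j. exp (\<i> * of_real (x $ j)))"

lemma continuous_torus_map: "continuous_on S torus_map"
  unfolding torus_map_def by (intro continuous_intros)

lemma torus_map_eq_iff:
  "torus_map x = torus_map y \<longleftrightarrow> (\<exists>m::'d \<Rightarrow> int. x = y + (\<chi> j. 2 * pi * of_int (m j)))"
  for x y :: "real^'d"
proof -
  have "exp (\<i> * of_real a) = exp (\<i> * of_real b) \<longleftrightarrow> (\<exists>n::int. a = b + 2 * pi * of_int n)" for a b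
  proof -
    have "\<i> * complex_of_real a = \<i> * complex_of_real b + of_int (2 * n) * of_real pi * \<i>
        \<longleftrightarrow> a = b + 2 * pi * of_int n" for n :: int
      by (auto simp: complex_eq_iff)
    then show ?thesis unfolding exp_eq by simp
  qed
  then show ?thesis
    by (auto simp: torus_map_def vec_eq_iff intro: choice)
qed

lemma V_sub_cos_sin:
  fixes j :: "'d::finite"
  shows "(\<lambda>x::real^'d. of_real (cos (x $ j))) \<in> V_sub UNIV" "(\<lambda>x::real^'d. of_real (sin (x $ j))) \<in> V_sub UNIV"
proof -
  have p: "(\<lambda>x::real^'d. exp (\<i> * of_real (x $ j))) \<in> V_sub UNIV"
    using V_sub_exp[of "axis j 1"] by (simp add: wave_def inner_vec_def axis_def if_distrib if_distribR sum.If_cases cong: if_cong)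
  have m: "(\<lambda>x::real^'d. exp (- (\<i> * of_real (x $ j)))) \<in> V_sub UNIV"
    using V_sub_exp[of "axis j (-1)"] by (simp add: wave_def inner_vec_def axis_def if_distrib if_distribR sum.If_cases cong: if_cong)
  show "(\<lambda>x::real^'d. of_real (cos (x $ j))) \<in> V_sub UNIV"
    using V_sub_scale[OF V_sub_add[OF p m], of "1/2"] by (simp add: cos_of_real[symmetric] cos_exp_eq)
  show "(\<lambda>x::real^'d. of_real (sin (x $ j))) \<in> V_sub UNIV"
    using V_sub_scale[OF V_sub_diff[OF p m], of "1/(2 * \<i>)"] by (simp add: sin_of_real[symmetric] sin_exp_eq)
qed

text \<open>A real polynomial on $\mathbb C^d$ is built from real-linear functionals, and on the torus such a
  functional is a combination of $\cos x_j$ and $\sin x_j$. So every polynomial becomes a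
  trigonometric polynomial.\<close>

lemma V_sub_real_polynomial_torus:
  fixes q :: "complex^'d \<Rightarrow> real"
  assumes "real_polynomial_function q"
  shows "(\<lambda>x. of_real (q (torus_map x))) \<in> V_sub UNIV"
  using assms
proof (induction rule: real_polynomial_function.induct)
  case (linear f)
  interpret bounded_linear f by fact
  have E: "torus_map x = (\<Sum>j\<in>UNIV. cos (x $ j) *\<^sub>R axis j 1 + sin (x $ j) *\<^sub>R axis j \<i>)" for x :: "real^'d"
    by (simp add: torus_map_def vec_eq_iff axis_def if_distrib if_distribR sum.If_cases cis_conv_exp[symmetric] complex_eq_iff cong: if_cong)
  have "(\<lambda>x. complex_of_real (f (torus_map x))) = (\<lambda>x. \<Sum>j\<in>UNIV.
      of_real (f (axis j 1)) * of_real (cos (x $ j)) + of_real (f (axis j \<i>)) * of_real (sin (x $ j)))"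
    by (simp add: E sum add scaleR mult.commute)
  moreover have "\<dots> \<in> V_sub UNIV"
    by (intro V_sub_sum V_sub_add V_sub_scale V_sub_cos_sin finite)
  ultimately show ?case by simp
next
  case (const c)
  then show ?case by (rule V_sub_const)
next
  case (add f g)
  then show ?case using V_sub_add by fastforce
next
  case (mult f g)
  then show ?case using V_sub_mult by fastforce
qed

text \<open>A function on the closed cube that takes equal values on points with the same image in the torus
  descends to the torus. It stays continuous there: preimages of closed sets are images of compact
  sets, as the cube is compact. The Stone--Weierstrass theorem on the torus then gives the
  approximation. The hypothesis is stated on the cube only, so that it also covers functions
  supported in the open cube, which need not be extended periodically.\<close>

lemma trig_approx_cube:
  fixes g :: "real^'d \<Rightarrow> complex"
  defines "C \<equiv> cbox 0 (\<chi> j. 2 * pi)"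
  assumes cont: "continuous_on C g"
    and per: "\<And>x y. x \<in> C \<Longrightarrow> y \<in> C \<Longrightarrow> torus_map x = torus_map y \<Longrightarrow> g x = g y"
    and "0 < e"
  shows "\<exists>p\<in>V_sub UNIV. \<forall>x\<in>C. cmod (g x - p x) < e"
proof -
  let ?T = "torus_map ` C"
  define G where "G z = g (inv_into C torus_map z)" for z
  have G: "G (torus_map x) = g x" if "x \<in> C" for x
    unfolding G_def by (rule per) (use that in \<open>auto simp: inv_into_into f_inv_into_f\<close>)
  have compC: "compact C" by (simp add: C_def)
  have compT: "compact ?T"
    by (rule compact_continuous_image[OF continuous_torus_map compC])
  have contG: "continuous_on ?T G"
    unfolding continuous_on_closed_vimage[OF compact_imp_closed[OF compT]]
  proof (intro allI impI)
    fix B :: "complex set" assume "closed B"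
    have "closed (g -` B \<inter> C)"
      using cont \<open>closed B\<close> continuous_on_closed_vimage[OF compact_imp_closed[OF compC]] by blast
    then have "compact (g -` B \<inter> C)"
      using compC by (metis closed_Int_compact inf.right_idem)
    then have "compact (torus_map ` (g -` B \<inter> C))"
      by (rule compact_continuous_image[OF continuous_torus_map])
    moreover have "G -` B \<inter> ?T = torus_map ` (g -` B \<inter> C)"
      using G by auto
    ultimately show "closed (G -` B \<inter> ?T)" by (simp add: compact_imp_closed)
  qed
  obtain q where q: "polynomial_function q" "\<forall>z\<in>?T. norm (G z - q z) < e"
    using Stone_Weierstrass_polynomial_function[OF compT contG \<open>0 < e\<close>] by blast
  have "real_polynomial_function (Re \<circ> q)" "real_polynomial_function (Im \<circ> q)"
    using q(1) bounded_linear_Re bounded_linear_Im unfolding polynomial_function_def by blast+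
  then have "(\<lambda>x. of_real ((Re \<circ> q) (torus_map x)) + \<i> * of_real ((Im \<circ> q) (torus_map x))) \<in> V_sub UNIV"
    by (intro V_sub_add V_sub_scale V_sub_real_polynomial_torus)
  moreover have "(\<lambda>x. of_real ((Re \<circ> q) (torus_map x)) + \<i> * of_real ((Im \<circ> q) (torus_map x))) = q \<circ> torus_map"
    by (simp add: fun_eq_iff complex_eq[symmetric])
  ultimately have "q \<circ> torus_map \<in> V_sub UNIV" by simp
  moreover have "\<forall>x\<in>C. cmod (g x - (q \<circ> torus_map) x) < e"
    using q(2) G by auto
  ultimately show ?thesis by blast
qed

text \<open>Invariance under the generators of the period lattice gives invariance under the whole lattice:
  first for natural, then for integer multiples of one generator, then coordinate by coordinate.\<close>

lemma periodic_shift: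
  fixes g :: "real^'d \<Rightarrow> 'b"
  assumes "periodic g"
  shows "g (x + (\<chi> j. 2 * pi * of_int (m j))) = g x"
proof -
  have nat: "g (x + axis j (2 * pi * of_nat n)) = g x" for x j n
  proof (induction n)
    case 0
    have "x + axis j 0 = x" by (simp add: axis_def vec_eq_iff)
    then show ?case by (simp only: of_nat_0 mult_zero_right)
  next
    case (Suc n)
    have "x + axis j (2 * pi * of_nat (Suc n)) = (x + axis j (2 * pi * of_nat n)) + axis j (2 * pi)"
      by (simp add: vec_eq_iff axis_def algebra_simps)
    then have "g (x + axis j (2 * pi * of_nat (Suc n))) = g (x + axis j (2 * pi * of_nat n))"
      using assms by (simp only: periodic_def)
    then show ?case using Suc by simp
  qed
  have int: "g (x + axis j (2 * pi * of_int n)) = g x" for x j n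
  proof (cases "n \<ge> 0")
    case True
    then show ?thesis using nat[of x j "nat n"] by simp
  next
    case False
    have "(x + axis j (2 * pi * of_int n)) + axis j (2 * pi * of_nat (nat (- n))) = x"
      using False by (simp add: vec_eq_iff axis_def algebra_simps)
    then show ?thesis using nat[of "x + axis j (2 * pi * of_int n)" j "nat (- n)"] by (simp only:)
  qed
  have "g (x + (\<Sum>j\<in>S. axis j (2 * pi * of_int (m j)))) = g x" if "finite S" for S
    using that
  proof (induction S rule: finite_induct)
    case (insert j S)
    then show ?case
      using int[of "x + (\<Sum>j\<in>S. axis j (2 * pi * of_int (m j)))" j "m j"] by (simp add: add_ac)
  qed simp
  moreover have "(\<Sum>j\<in>UNIV. axis j (2 * pi * of_int (m j))) = (\<chi> j. 2 * pi * of_int (m j))"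
    by (simp add: vec_eq_iff axis_def)
  ultimately show ?thesis by (metis finite)
qed

lemma periodic_torus_map:
  fixes g :: "real^'d \<Rightarrow> 'b"
  shows "periodic g \<Longrightarrow> torus_map x = torus_map y \<Longrightarrow> g x = g y"
  using periodic_shift by (auto simp: torus_map_eq_iff)

lemma torus_map_cube:
  fixes x :: "real^'d"
  obtains y where "y \<in> cbox 0 (\<chi> j. 2 * pi)" "torus_map x = torus_map y"
proof -
  let ?y = "(\<chi> j. x $ j - 2 * pi * of_int \<lfloor>x $ j / (2 * pi)\<rfloor>) :: real^'d"
  have "x = ?y + (\<chi> j. 2 * pi * of_int \<lfloor>x $ j / (2 * pi)\<rfloor>)" by (simp add: vec_eq_iff)
  then have 1: "torus_map x = torus_map ?y"
    unfolding torus_map_eq_iff by (rule exI[of _ "\<lambda>j. \<lfloor>x $ j / (2 * pi)\<rfloor>"])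
  have "0 \<le> t - 2 * pi * of_int \<lfloor>t / (2 * pi)\<rfloor>" "t - 2 * pi * of_int \<lfloor>t / (2 * pi)\<rfloor> \<le> 2 * pi" for t
    using floor_divide_lower[of "2 * pi" t] floor_divide_upper[of "2 * pi" t]
    by (simp_all add: algebra_simps)
  then have "?y \<in> cbox 0 (\<chi> j. 2 * pi)" by (auto simp: mem_box_cart)
  with 1 show ?thesis using that by blast
qed

lemma periodic_phi: "periodic (phi k)"
proof -
  have "exp (\<i> * of_real (wave k \<bullet> (x + axis j (2 * pi)))) = exp (\<i> * of_real (wave k \<bullet> x))" for x j
    unfolding exp_eq
    by (rule exI[of _ "k $ j"]) (simp add: inner_add_right cart_eq_inner_axis[symmetric] inner_axis wave_def algebra_simps)
  then show ?thesis by (simp add: periodic_def phi_def)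
qed

lemma V_sub_periodic: "v \<in> V_sub \<Lambda> \<Longrightarrow> periodic v"
  by (induction rule: V_sub_induct) (auto simp: periodic_def periodic_phi[unfolded periodic_def, rule_format])

lemma trig_approx_periodic:
  fixes g :: "real^'d \<Rightarrow> complex"
  assumes "periodic g" "continuous_on UNIV g" "0 < e"
  obtains p where "p \<in> V_sub UNIV" "\<And>x. cmod (g x - p x) < e"
proof -
  obtain p where p: "p \<in> V_sub UNIV" "\<forall>x\<in>cbox 0 (\<chi> j. 2 * pi). cmod (g x - p x) < e"
    using trig_approx_cube[of g e] assms periodic_torus_map[OF assms(1)]
    by (metis continuous_on_subset subset_UNIV)
  have "cmod (g x - p x) < e" for x
  proof -
    obtain y where "y \<in> cbox 0 (\<chi> j. 2 * pi)" "torus_map x = torus_map y"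
      using torus_map_cube by blast
    then show ?thesis
      using p periodic_torus_map[OF assms(1)] periodic_torus_map[OF V_sub_periodic[OF p(1)]] by metis
  qed
  then show ?thesis using that p by blast
qed

section \<open>Completeness of the Fourier basis\<close>

text \<open>By approximation, \<open>h\<close> is orthogonal to every continuous function that vanishes outside the open
  cube. The bounded measurable function $\bar h / (1 + |h|)$ is almost everywhere the limit of such
  functions with values in the unit disc, so dominated convergence gives
  $\int |h|^2 / (1 + |h|) = 0$.\<close>

lemma fourier_zero_imp_AE_zero:
  fixes h :: "real^'d \<Rightarrow> complex"
  assumes h: "L2 h" and ortho: "\<And>k. (\<integral>x. h x * phi k x \<partial>lebesgue_on Omega) = 0"
  shows "AE x in lebesgue_on Omega. h x = 0"
proof -
  let ?M = "lebesgue_on (Omega :: (real^'d) set)"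
  have hm [measurable]: "h \<in> borel_measurable ?M" using h by (simp add: L2_def)
  have trig: "(\<integral>x. h x * p x \<partial>?M) = 0" if "p \<in> V_sub UNIV" for p
    using that
  proof (induction rule: V_sub_induct)
    case (step c k v)
    have "integrable ?M (\<lambda>x. h x * phi k x)" "integrable ?M (\<lambda>x. h x * v x)"
      using step V_sub_continuous continuous_phi by (auto intro!: L2_integrable_mult h L2_continuous)
    then have "(\<integral>x. c * (h x * phi k x) + h x * v x \<partial>?M) = 0"
      using step ortho by simp
    then show ?case by (simp add: algebra_simps)
  qed simp
  have cont: "(\<integral>x. h x * g x \<partial>?M) = 0"
    if g: "continuous_on UNIV g" and supp: "\<And>x. x \<notin> Omega \<Longrightarrow> g x = 0" for g
  proof -
    have per: "g x = g y" if xy: "x \<in> cbox 0 (\<chi> j. 2 * pi)" "y \<in> cbox 0 (\<chi> j. 2 * pi)"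
      and eq: "torus_map x = torus_map y" for x y
    proof -
      have half: "x = y" if "x \<in> Omega" "y \<in> cbox 0 (\<chi> j. 2 * pi)" "torus_map x = torus_map y"
        for x y :: "real^'d"
      proof -
        obtain m :: "'d \<Rightarrow> int" where m: "x = y + (\<chi> j. 2 * pi * of_int (m j))"
          using \<open>torus_map x = torus_map y\<close> torus_map_eq_iff by blast
        have "m j = 0" for j
        proof -
          have "0 < x $ j" "x $ j < 2 * pi" "0 \<le> y $ j" "y $ j \<le> 2 * pi"
            using that by (auto simp: Omega_def mem_box_cart)
          moreover have "x $ j = y $ j + 2 * pi * of_int (m j)" by (subst m) simp
          ultimately have "2 * pi * of_int (m j) < 2 * pi * 1" "2 * pi * (-1) < 2 * pi * of_int (m j)"
            by linarith+
          then have "real_of_int (m j) < 1" "-1 < real_of_int (m j)"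
            using mult_less_cancel_left_pos[of "2 * pi"] pi_gt_zero by fastforce+
          then show ?thesis by linarith
        qed
        then show ?thesis using m by (simp add: vec_eq_iff)
      qed
      show ?thesis
        using half[of x y] half[of y x] xy eq supp by metis
    qed
    have int_g: "integrable ?M (\<lambda>x. h x * g x)"
      by (intro L2_integrable_mult h L2_continuous g)
    define H where "H = (\<integral>x. cmod (h x) \<partial>?M)"
    have H0: "0 \<le> H" by (simp add: H_def)
    have bound: "cmod (\<integral>x. h x * g x \<partial>?M) \<le> e * H" if e: "0 < e" for e
    proof -
      obtain p where p: "p \<in> V_sub UNIV" "\<forall>x\<in>cbox 0 (\<chi> j. 2 * pi). cmod (g x - p x) < e"
        using trig_approx_cube[of g e] per e continuous_on_subset[OF g] by (metis subset_UNIV)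
      have int_p: "integrable ?M (\<lambda>x. h x * p x)"
        by (intro L2_integrable_mult h L2_continuous V_sub_continuous[OF p(1)])
      have "(\<integral>x. h x * g x \<partial>?M) = (\<integral>x. h x * g x - h x * p x \<partial>?M)"
        using int_g int_p trig[OF p(1)] by simp
      also have "cmod \<dots> \<le> (\<integral>x. e * cmod (h x) \<partial>?M)"
      proof (rule Bochner_Integration.integral_norm_bound_integral)
        show "integrable ?M (\<lambda>x. h x * g x - h x * p x)" using int_g int_p by simp
        show "integrable ?M (\<lambda>x. e * cmod (h x))" using L2_integrable[OF h] by simp
        fix x assume "x \<in> space ?M"
        then have "x \<in> cbox 0 (\<chi> j. 2 * pi)" using Omega_subset_cube by auto
        then have "cmod (g x - p x) * cmod (h x) \<le> e * cmod (h x)"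
          using p by (intro mult_right_mono) (auto intro: less_imp_le)
        moreover have "h x * g x - h x * p x = (g x - p x) * h x"
          by (simp add: algebra_simps)
        ultimately show "cmod (h x * g x - h x * p x) \<le> e * cmod (h x)"
          by (simp add: norm_mult)
      qed
      also have "\<dots> = e * H" by (simp add: H_def)
      finally show ?thesis .
    qed
    then have "cmod (\<integral>x. h x * g x \<partial>?M) \<le> 0 + e" if "0 < e" for e
    proof -
      have "e / (H + 1) * H \<le> e"
        using that H0 by (simp add: field_simps)
      then show ?thesis
        using bound[of "e / (H + 1)"] that H0 by simp
    qed
    then have "cmod (\<integral>x. h x * g x \<partial>?M) \<le> 0" by (rule field_le_epsilon)
    then show ?thesis by simp
  qed
  \<comment> \<open>division by $1 + |h|$ keeps \<open>h x * b x\<close> integrable and nonnegative\<close>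
  define b where "b x = cnj (h x) / of_real (1 + cmod (h x))" for x
  have [measurable]: "(\<lambda>x. cnj (h x)) \<in> borel_measurable ?M"
    using L2_cnj[OF h] by (simp add: L2_def)
  have "b \<in> borel_measurable ?M" unfolding b_def by measurable
  then have "b measurable_on Omega" by (simp add: measurable_on_iff_borel_measurable)
  then obtain N g where N: "negligible N" and g: "\<And>n. continuous_on UNIV (g n)"
    and lim: "\<And>x. x \<notin> N \<Longrightarrow> (\<lambda>n. g n x) \<longlonglongrightarrow> (if x \<in> Omega then b x else 0)"
    unfolding measurable_on_def by blast
  \<comment> \<open>the first factor is a cutoff that increases to $1$ on the open cube, the second truncates to the unit disc\<close>
  define G where "G n x = of_real (min 1 (real n * infdist x (- Omega))) * (g n x / of_real (max 1 (cmod (g n x))))"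
    for n :: nat and x :: "real^'d"
  have b1: "cmod (b x) \<le> 1" for x
    by (simp add: b_def norm_divide add_pos_nonneg del: of_real_add)
  have G1: "cmod (G n x) \<le> 1" for n x
    unfolding G_def norm_mult norm_divide norm_of_real
    by (intro mult_le_one) (auto simp: infdist_nonneg divide_le_eq_1)
  have GC: "continuous_on UNIV (G n)" for n
    unfolding G_def by (intro continuous_intros g) auto
  have G0: "G n x = 0" if "x \<notin> Omega" for n x
    using that by (simp add: G_def)
  have "(0::real^'d) \<notin> Omega" by (auto simp: Omega_def)
  then have ne: "- (Omega :: (real^'d) set) \<noteq> {}" by blast
  have closed: "closed (- (Omega :: (real^'d) set))" by (simp add: Omega_box closed_def open_box)
  have Glim: "(\<lambda>n. G n x) \<longlonglongrightarrow> b x" if x: "x \<in> Omega" "x \<notin> N" for x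
  proof -
    have d: "0 < infdist x (- Omega)"
      using x infdist_pos_not_in_closed[OF closed ne, of x] by simp
    have "\<forall>\<^sub>F n in sequentially. 1 / infdist x (- Omega) < real n"
      using filterlim_real_sequentially filterlim_at_top_dense by blast
    then have "\<forall>\<^sub>F n in sequentially. min 1 (real n * infdist x (- Omega)) = 1"
      by eventually_elim (use d in \<open>auto simp: field_simps min_def\<close>)
    then have 1: "(\<lambda>n. min 1 (real n * infdist x (- Omega))) \<longlonglongrightarrow> 1"
      by (rule tendsto_eventually)
    have gl: "(\<lambda>n. g n x) \<longlonglongrightarrow> b x" using lim[of x] x by simp
    have "(\<lambda>n. G n x) \<longlonglongrightarrow> of_real 1 * (b x / of_real (max 1 (cmod (b x))))"
      unfolding G_def by (intro tendsto_intros 1 gl) auto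
    then show ?thesis using b1[of x] by (simp add: max_absorb1)
  qed
  have "(\<lambda>n. \<integral>x. h x * G n x \<partial>?M) \<longlonglongrightarrow> (\<integral>x. h x * b x \<partial>?M)"
  proof (rule integral_dominated_convergence[where w = "\<lambda>x. cmod (h x)"])
    show "(\<lambda>x. h x * b x) \<in> borel_measurable ?M" unfolding b_def by measurable
    have [measurable]: "G n \<in> borel_measurable ?M" for n
      by (rule continuous_measurable_Omega[OF GC])
    show "(\<lambda>x. h x * G n x) \<in> borel_measurable ?M" for n by measurable
    show "integrable ?M (\<lambda>x. cmod (h x))" using L2_integrable[OF h] by simp
    show "AE x in ?M. cmod (h x * G n x) \<le> cmod (h x)" for n
      using G1[of n] by (auto simp: norm_mult mult_left_le)
    have "N \<in> null_sets lebesgue" using N by (simp add: negligible_iff_null_sets)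
    then have "AE x in lebesgue. x \<notin> N" by (rule AE_not_in)
    then have "AE x in ?M. x \<notin> N"
      by (subst AE_restrict_space_iff) (auto elim: eventually_mono)
    then show "AE x in ?M. (\<lambda>n. h x * G n x) \<longlonglongrightarrow> h x * b x"
      using AE_space by eventually_elim (auto intro!: tendsto_intros Glim)
  qed
  moreover have "(\<integral>x. h x * G n x \<partial>?M) = 0" for n
    by (rule cont) (use GC G0 in auto)
  ultimately have "(\<integral>x. h x * b x \<partial>?M) = 0"
    by (simp add: LIMSEQ_const_iff)
  moreover have hb: "h x * b x = of_real ((cmod (h x))\<^sup>2 / (1 + cmod (h x)))" for x
    using complex_norm_square[of "h x"] by (simp add: b_def)
  ultimately have "(\<integral>x. (cmod (h x))\<^sup>2 / (1 + cmod (h x)) \<partial>?M) = 0"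
    unfolding hb by (simp only: integral_complex_of_real of_real_eq_0_iff)
  moreover have "integrable ?M (\<lambda>x. (cmod (h x))\<^sup>2 / (1 + cmod (h x)))"
  proof (rule Bochner_Integration.integrable_bound[where f = "\<lambda>x. cmod (h x)"])
    show "integrable ?M (\<lambda>x. cmod (h x))" using L2_integrable[OF h] by simp
    have "t\<^sup>2 / (1 + t) \<le> t" if "0 \<le> t" for t :: real
      using that by (simp add: divide_le_eq power2_eq_square algebra_simps)
    then show "AE x in ?M. norm ((cmod (h x))\<^sup>2 / (1 + cmod (h x))) \<le> norm (cmod (h x))"
      by auto
  qed measurable
  ultimately have "AE x in ?M. (cmod (h x))\<^sup>2 / (1 + cmod (h x)) = 0"
    by (subst (asm) integral_nonneg_eq_0_iff_AE) auto
  then show ?thesis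
  proof eventually_elim
    case (elim x)
    then show ?case by (auto simp: add_nonneg_eq_0_iff)
  qed
qed

section \<open>Integration by parts on the torus\<close>

lemma integral_phi_translate:
  "(\<integral>x. phi k (x + a) \<partial>lebesgue_on Omega) = (\<integral>x. phi k x \<partial>lebesgue_on Omega)"
proof (cases "k = 0")
  case True
  then show ?thesis by (simp add: phi_def wave_def inner_vec_def)
next
  case False
  let ?c = "of_real ((2 * pi) powr (- (real CARD('a) / 2))) :: complex"
  have 0: "phi (0 :: int^'a) x = ?c" for x
    by (simp add: phi_def wave_def inner_vec_def)
  have "(\<integral>x. phi k x \<partial>lebesgue_on Omega) * cnj ?c = 0"
    using phi_orthonormal[of k 0] False by (simp add: 0)
  then have z: "(\<integral>x. phi k x \<partial>lebesgue_on Omega) = 0" by simp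
  have "phi k (x + a) = exp (\<i> * of_real (wave k \<bullet> a)) * phi k x" for x
    by (simp add: phi_def inner_add_right distrib_left exp_add)
  then show ?thesis using z by simp
qed

text \<open>For a basis function both integrals vanish unless its frequency is zero, when it is constant; the
  general case follows by uniform approximation. In this way the cube never has to be cut and
  reassembled.\<close>

lemma integral_periodic_translate:
  fixes g :: "real^'d \<Rightarrow> complex"
  assumes per: "periodic g" and cont: "continuous_on UNIV g"
  shows "(\<integral>x. g (x + a) \<partial>lebesgue_on Omega) = (\<integral>x. g x \<partial>lebesgue_on Omega)"
proof -
  let ?M = "lebesgue_on (Omega :: (real^'d) set)"
  have cs: "continuous_on UNIV (\<lambda>x. h (x + a))" if "continuous_on UNIV h" for h :: "real^'d \<Rightarrow> complex"
    by (rule continuous_on_compose2[OF that]) (auto intro!: continuous_intros)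
  have trig: "(\<integral>x. p (x + a) \<partial>?M) = (\<integral>x. p x \<partial>?M)" if "p \<in> V_sub UNIV" for p
    using that
  proof (induction rule: V_sub_induct)
    case (step c k v)
    have "continuous_on UNIV v" "continuous_on UNIV (phi k)"
      using step V_sub_continuous continuous_phi by auto
    note i = integrable_continuous_Omega[OF this(1)] integrable_continuous_Omega[OF this(2)]
      integrable_continuous_Omega[OF cs[OF this(1)]] integrable_continuous_Omega[OF cs[OF this(2)]]
    then show ?case using step.IH by (simp add: integral_phi_translate)
  qed simp
  define V where "V = measure ?M (space ?M)"
  have V: "0 \<le> V" by (simp add: V_def)
  have bound: "cmod ((\<integral>x. g (x + a) \<partial>?M) - (\<integral>x. g x \<partial>?M)) \<le> 2 * V * e" if e: "0 < e" for e
  proof -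
    obtain p where p: "p \<in> V_sub UNIV" "\<And>x. cmod (g x - p x) < e"
      using trig_approx_periodic[OF per cont e] by metis
    note pc = V_sub_continuous[OF p(1)]
    have A: "cmod ((\<integral>x. g (x + b) \<partial>?M) - (\<integral>x. p (x + b) \<partial>?M)) \<le> V * e"
      if c: "continuous_on UNIV (\<lambda>x. g (x + b))" "continuous_on UNIV (\<lambda>x. p (x + b))" for b
    proof -
      note i = integrable_continuous_Omega[OF c(1)] integrable_continuous_Omega[OF c(2)]
      have "cmod (\<integral>x. g (x + b) - p (x + b) \<partial>?M) \<le> (\<integral>x. e \<partial>?M)"
        by (rule Bochner_Integration.integral_norm_bound_integral)
           (use i p in \<open>auto intro: less_imp_le\<close>)
      then show ?thesis using i by (simp add: V_def)
    qed
    have "(\<integral>x. g (x + a) \<partial>?M) - (\<integral>x. g x \<partial>?M)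
        = ((\<integral>x. g (x + a) \<partial>?M) - (\<integral>x. p (x + a) \<partial>?M)) - ((\<integral>x. g (x + 0) \<partial>?M) - (\<integral>x. p (x + 0) \<partial>?M))"
      by (simp add: trig[OF p(1)])
    also have "cmod \<dots> \<le> V * e + V * e"
      by (rule order_trans[OF norm_triangle_ineq4 add_mono]) (rule A; use cs cont pc in simp)+
    finally show ?thesis by simp
  qed
  have "cmod ((\<integral>x. g (x + a) \<partial>?M) - (\<integral>x. g x \<partial>?M)) \<le> 0 + e" if "0 < e" for e
  proof -
    have "2 * V * (e / (2 * V + 1)) \<le> e"
      using that V by (simp add: field_simps)
    then show ?thesis
      using bound[of "e / (2 * V + 1)"] that V by simp
  qed
  then have "cmod ((\<integral>x. g (x + a) \<partial>?M) - (\<integral>x. g x \<partial>?M)) \<le> 0" by (rule field_le_epsilon)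
  then show ?thesis by simp
qed

lemma C1_continuous: "C1 v \<Longrightarrow> continuous_on UNIV v"
  unfolding C1_def
  by (intro continuous_at_imp_continuous_on ballI differentiable_imp_continuous_within) auto

text \<open>The mean of a periodic function does not change under translation, so the difference quotients in
  direction \<open>j\<close> have mean zero. They converge to the partial derivative and are bounded by its
  supremum over a slightly larger cube, whence dominated convergence applies.\<close>

lemma integral_partial_deriv_periodic:
  fixes g :: "real^'d \<Rightarrow> complex"
  assumes per: "periodic g" and g: "C1 g"
  shows "(\<integral>x. partial_deriv j g x \<partial>lebesgue_on Omega) = 0"
proof -
  let ?M = "lebesgue_on (Omega :: (real^'d) set)"
  let ?e = "axis j 1 :: real^'d"
  let ?t = "\<lambda>n::nat. inverse (real (Suc n))"
  have cont: "continuous_on UNIV g" by (rule C1_continuous[OF g])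
  have dcont: "continuous_on UNIV (partial_deriv j g)" using g by (simp add: C1_def)
  have der: "(g has_derivative frechet_derivative g (at x)) (at x)" for x
    using g frechet_derivative_works by (auto simp: C1_def)
  define s where "s n x = real (Suc n) *\<^sub>R (g (x + ?t n *\<^sub>R ?e) - g x)" for n x
  have s0: "(\<integral>x. s n x \<partial>?M) = 0" for n
  proof -
    have "continuous_on UNIV (\<lambda>x. g (x + ?t n *\<^sub>R ?e))"
      by (rule continuous_on_compose2[OF cont]) (auto intro!: continuous_intros)
    then show ?thesis
      unfolding s_def using cont
      by (simp add: integrable_continuous_Omega integral_periodic_translate[OF per cont])
  qed
  \<comment> \<open>translates of the cube by at most $1$ in direction \<open>?e\<close> stay in this larger cube\<close>
  have "compact (partial_deriv j g ` cbox 0 (\<chi> i. 2 * pi + 1))"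
    using dcont by (intro compact_continuous_image) (auto intro: continuous_on_subset)
  then obtain B where B: "\<And>y. y \<in> cbox 0 (\<chi> i. 2 * pi + 1) \<Longrightarrow> cmod (partial_deriv j g y) \<le> B"
    using compact_imp_bounded bounded_iff by (metis imageI)
  have sB: "cmod (s n x) \<le> B" if x: "x \<in> Omega" for n x
  proof -
    let ?h = "\<lambda>t. g (x + t *\<^sub>R ?e)"
    have hd: "(?h has_derivative (\<lambda>r. r *\<^sub>R partial_deriv j g (x + t *\<^sub>R ?e))) (at t within {0..1})" for t
    proof -
      have lin: "bounded_linear (frechet_derivative g (at (x + t *\<^sub>R ?e)))"
        by (rule has_derivative_bounded_linear[OF der])
      have "((\<lambda>t. x + t *\<^sub>R ?e) has_derivative (\<lambda>r. r *\<^sub>R ?e)) (at t within {0..1})"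
        by (auto intro!: derivative_eq_intros)
      from has_derivative_compose[OF this der] show ?thesis
        by (simp add: partial_deriv_def linear_scale[OF bounded_linear.linear[OF lin]])
    qed
    have "norm (?h (?t n) - ?h 0) \<le> B * norm (?t n - 0)"
    proof (rule differentiable_bound[OF convex_real_interval(5)[of 0 1] hd])
      fix t :: real assume t: "t \<in> {0..1}"
      have "x + t *\<^sub>R ?e \<in> cbox 0 (\<chi> i. 2 * pi + 1)"
        unfolding mem_box_cart
      proof
        fix i
        have "0 < x $ i" "x $ i < 2 * pi" using x by (auto simp: Omega_def)
        moreover have "0 \<le> (t *\<^sub>R ?e) $ i" "(t *\<^sub>R ?e) $ i \<le> 1" using t by (auto simp: axis_def)
        ultimately show "0 $ i \<le> (x + t *\<^sub>R ?e) $ i \<and> (x + t *\<^sub>R ?e) $ i \<le> (\<chi> i. 2 * pi + 1) $ i"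
          by simp
      qed
      then have "cmod (partial_deriv j g (x + t *\<^sub>R ?e)) \<le> B" by (rule B)
      then show "onorm (\<lambda>r. r *\<^sub>R partial_deriv j g (x + t *\<^sub>R ?e)) \<le> B"
        by (intro onorm_le) (simp add: mult.commute[of B] mult_left_mono)
    qed (auto simp: field_simps)
    then have "real (Suc n) * norm (?h (?t n) - ?h 0) \<le> B"
      by (simp add: field_simps)
    then show ?thesis by (simp add: s_def)
  qed
  have slim: "(\<lambda>n. s n x) \<longlonglongrightarrow> partial_deriv j g x" for x
  proof -
    have lin: "bounded_linear (frechet_derivative g (at x))"
      by (rule has_derivative_bounded_linear[OF der])
    have "((\<lambda>h. norm (g (x + h) - g x - frechet_derivative g (at x) h) / norm h) \<longlongrightarrow> 0) (at 0)"
      using der[of x] unfolding has_derivative_at by simp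
    moreover have "filterlim (\<lambda>n. ?t n *\<^sub>R ?e) (at 0) sequentially"
    proof (rule filterlim_atI)
      show "(\<lambda>n. ?t n *\<^sub>R ?e) \<longlonglongrightarrow> 0"
        using tendsto_scaleR[OF LIMSEQ_inverse_real_of_nat tendsto_const[of ?e]] by simp
    qed (simp add: axis_eq_0_iff)
    ultimately have l: "(\<lambda>n. norm (g (x + ?t n *\<^sub>R ?e) - g x - frechet_derivative g (at x) (?t n *\<^sub>R ?e))
        / norm (?t n *\<^sub>R ?e)) \<longlonglongrightarrow> 0"
      by (rule filterlim_compose)
    have "norm (g (x + ?t n *\<^sub>R ?e) - g x - frechet_derivative g (at x) (?t n *\<^sub>R ?e)) / norm (?t n *\<^sub>R ?e)
        = norm (s n x - partial_deriv j g x)" for n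
    proof -
      have "s n x - partial_deriv j g x = real (Suc n) *\<^sub>R (g (x + ?t n *\<^sub>R ?e) - g x - ?t n *\<^sub>R partial_deriv j g x)"
        by (simp add: s_def scaleR_diff_right del: of_nat_Suc)
      moreover have "frechet_derivative g (at x) (?t n *\<^sub>R ?e) = ?t n *\<^sub>R partial_deriv j g x"
        by (simp only: partial_deriv_def linear_scale[OF bounded_linear.linear[OF lin]])
      moreover have "norm (?t n *\<^sub>R ?e) = ?t n" by simp
      ultimately show ?thesis
        by (simp add: divide_inverse mult.commute del: of_nat_Suc)
    qed
    then have "(\<lambda>n. norm (s n x - partial_deriv j g x)) \<longlonglongrightarrow> 0" using l by simp
    then show ?thesis by (rule LIM_zero_cancel[OF tendsto_norm_zero_cancel])
  qed
  have "(\<lambda>n. \<integral>x. s n x \<partial>?M) \<longlonglongrightarrow> (\<integral>x. partial_deriv j g x \<partial>?M)"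
  proof (rule integral_dominated_convergence[where w = "\<lambda>_. B"])
    show "partial_deriv j g \<in> borel_measurable ?M" by (rule continuous_measurable_Omega[OF dcont])
    have "continuous_on UNIV (s n)" for n
      unfolding s_def by (intro continuous_intros cont continuous_on_compose2[OF cont]) auto
    then show "s n \<in> borel_measurable ?M" for n by (rule continuous_measurable_Omega)
    show "AE x in ?M. (\<lambda>n. s n x) \<longlonglongrightarrow> partial_deriv j g x" using slim by simp
    show "AE x in ?M. cmod (s n x) \<le> B" for n using sB by (auto intro!: AE_I2)
  qed simp
  then show ?thesis by (simp add: s0 LIMSEQ_const_iff)
qed

lemma phi_has_derivative:
  "(phi k has_derivative (\<lambda>h. \<i> * of_real (wave k \<bullet> h) * phi k x)) (at x)"
proof -
  have "((\<lambda>x. \<i> * of_real (wave k \<bullet> x)) has_derivative (\<lambda>h. \<i> * of_real (wave k \<bullet> h))) (at x)"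
    by (auto intro!: derivative_eq_intros)
  from has_derivative_compose[OF this has_field_derivative_imp_has_derivative[OF DERIV_exp]]
  have "((\<lambda>x. exp (\<i> * of_real (wave k \<bullet> x))) has_derivative
      (\<lambda>h. exp (\<i> * of_real (wave k \<bullet> x)) * (\<i> * of_real (wave k \<bullet> h)))) (at x)" .
  from has_derivative_mult_right[OF this, of "of_real ((2 * pi) powr (- (real CARD('a) / 2)))"]
  show ?thesis unfolding phi_def by (simp add: mult_ac)
qed

lemma partial_deriv_phi: "partial_deriv j (phi k) x = \<i> * of_int (k $ j) * phi k x"
  using frechet_derivative_at[OF phi_has_derivative[of k x], symmetric]
  by (simp add: partial_deriv_def cart_eq_inner_axis[symmetric] wave_def)

lemma C1_phi: "C1 (phi k)"
proof -
  have "partial_deriv j (phi k) = (\<lambda>x. \<i> * of_int (k $ j) * phi k x)" for j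
    by (rule ext) (rule partial_deriv_phi)
  then show ?thesis
    using phi_has_derivative[of k]
    by (auto simp: C1_def differentiable_def intro!: continuous_intros continuous_phi)
qed

text \<open>This is integration by parts: the product of \<open>phi k\<close> with a periodic test function is itself periodic
  and continuously differentiable, so its partial derivatives have mean zero.\<close>

lemma has_weak_gradient_phi:
  fixes k :: "int^'d"
  shows "has_weak_gradient (phi k) (\<lambda>x. \<chi> j. \<i> * of_int (k $ j) * phi k x)"
  unfolding has_weak_gradient_def
proof (intro conjI allI impI; (elim conjE)?)
  show "L2 (\<lambda>x. \<chi> j. \<i> * of_int (k $ j) * phi k x)"
    by (intro L2_continuous continuous_intros continuous_phi)
next
  fix \<psi> :: "real^'d \<Rightarrow> complex" and j
  assume per: "periodic \<psi>" and C1: "C1 \<psi>"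
  let ?M = "lebesgue_on (Omega :: (real^'d) set)"
  let ?F = "\<lambda>x. phi k x * \<psi> x"
  have \<psi>c: "continuous_on UNIV \<psi>" by (rule C1_continuous[OF C1])
  have dc: "continuous_on UNIV (partial_deriv i \<psi>)" for i using C1 by (simp add: C1_def)
  have der: "(\<psi> has_derivative frechet_derivative \<psi> (at x)) (at x)" for x
    using C1 frechet_derivative_works by (auto simp: C1_def)
  have Fd: "(?F has_derivative (\<lambda>h. phi k x * frechet_derivative \<psi> (at x) h
      + \<i> * of_real (wave k \<bullet> h) * phi k x * \<psi> x)) (at x)" for x
    by (rule has_derivative_mult[OF phi_has_derivative der])
  have pF: "partial_deriv i ?F = (\<lambda>x. phi k x * partial_deriv i \<psi> x + \<i> * of_int (k $ i) * phi k x * \<psi> x)" for i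
  proof (rule ext)
    fix x
    show "partial_deriv i ?F x = phi k x * partial_deriv i \<psi> x + \<i> * of_int (k $ i) * phi k x * \<psi> x"
      using frechet_derivative_at[OF Fd[of x], symmetric]
      by (simp add: partial_deriv_def cart_eq_inner_axis[symmetric] wave_def)
  qed
  have "C1 ?F"
    unfolding C1_def pF using Fd
    by (auto simp: differentiable_def intro!: continuous_intros continuous_phi \<psi>c dc)
  moreover have "periodic ?F" using per periodic_phi[of k] by (simp add: periodic_def)
  ultimately have "(\<integral>x. partial_deriv j ?F x \<partial>?M) = 0"
    by (intro integral_partial_deriv_periodic)
  moreover have "integrable ?M (\<lambda>x. phi k x * partial_deriv j \<psi> x)"
    "integrable ?M (\<lambda>x. \<i> * of_int (k $ j) * phi k x * \<psi> x)"
    by (intro integrable_continuous_Omega continuous_intros continuous_phi \<psi>c dc)+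
  ultimately have "(\<integral>x. phi k x * partial_deriv j \<psi> x \<partial>?M) + (\<integral>x. \<i> * of_int (k $ j) * phi k x * \<psi> x \<partial>?M) = 0"
    by (simp add: pF)
  then show "(\<integral>x. phi k x * partial_deriv j \<psi> x \<partial>?M)
      = - (\<integral>x. (\<chi> j. \<i> * of_int (k $ j) * phi k x) $ j * \<psi> x \<partial>?M)"
    by (simp add: eq_neg_iff_add_eq_0)
qed

section \<open>Weak gradients of periodic functions\<close>

lemma has_weak_gradient_integral:
  fixes v :: "real^'d \<Rightarrow> complex"
  assumes "has_weak_gradient v g"
  shows "(\<integral>x. g x $ j * phi k x \<partial>lebesgue_on Omega)
    = - (\<i> * of_int (k $ j) * (\<integral>x. v x * phi k x \<partial>lebesgue_on Omega))"
proof -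
  let ?M = "lebesgue_on (Omega :: (real^'d) set)"
  have "(\<integral>x. v x * partial_deriv j (phi k) x \<partial>?M) = - (\<integral>x. g x $ j * phi k x \<partial>?M)"
    using assms C1_phi periodic_phi unfolding has_weak_gradient_def by blast
  moreover have "(\<integral>x. v x * partial_deriv j (phi k) x \<partial>?M) = (\<integral>x. \<i> * of_int (k $ j) * (v x * phi k x) \<partial>?M)"
    by (simp add: partial_deriv_phi mult_ac)
  ultimately show ?thesis by (simp add: minus_equation_iff)
qed

text \<open>Fourier coefficients pair with the conjugate of \<open>phi k\<close>, weak gradients are tested without
  conjugation; passing to \<open>- k\<close> translates between the two.\<close>

lemma cnj_phi: "cnj (phi k x) = phi (- k) x"
proof -
  have "wave (- k) = - wave k" by (simp add: wave_def vec_eq_iff)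
  then show ?thesis by (simp add: phi_def exp_cnj)
qed

lemma fourier_coeff_weak_gradient:
  assumes "has_weak_gradient v g"
  shows "fourier_coeff (\<lambda>x. g x $ j) k = \<i> * of_int (k $ j) * fourier_coeff v k"
  using has_weak_gradient_integral[OF assms, of j "- k"]
  by (simp add: fourier_coeff_def cnj_phi)

lemma has_weak_gradient_L2:
  "has_weak_gradient v g \<Longrightarrow> L2 (\<lambda>x. g x $ j)"
  unfolding has_weak_gradient_def by (blast intro: L2_vec_nth)

text \<open>Testing with the basis functions shows that two weak gradients have the same Fourier
  coefficients; completeness of the basis does the rest. Uniqueness is what makes the choice in
  \<open>grad\<close> harmless: it turns linearity of weak gradients into linearity of \<open>grad\<close> almost everywhere.\<close>

lemma has_weak_gradient_unique:
  fixes v :: "real^'d \<Rightarrow> complex"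
  assumes g: "has_weak_gradient v g" and g': "has_weak_gradient v g'"
  shows "AE x in lebesgue_on Omega. g x = g' x"
proof -
  have "AE x in lebesgue_on Omega. g x $ j - g' x $ j = 0" for j
  proof (rule fourier_zero_imp_AE_zero)
    note L = has_weak_gradient_L2[OF g, of j] has_weak_gradient_L2[OF g', of j]
    show "L2 (\<lambda>x. g x $ j - g' x $ j)"
      using L2_add[OF L(1) L2_scale[OF L(2), of "-1"]] by simp
    fix k :: "int^'d"
    have "L2 (phi k)" by (rule L2_continuous[OF continuous_phi])
    then show "(\<integral>x. (g x $ j - g' x $ j) * phi k x \<partial>lebesgue_on Omega) = 0"
      using L by (simp add: left_diff_distrib L2_integrable_mult
          has_weak_gradient_integral[OF g] has_weak_gradient_integral[OF g'])
  qed
  then have "AE x in lebesgue_on Omega. \<forall>j. g x $ j - g' x $ j = 0"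
    by (subst AE_all_countable) simp
  then show ?thesis by eventually_elim (simp add: vec_eq_iff)
qed

lemma has_weak_gradient_add:
  fixes v w :: "real^'d \<Rightarrow> complex"
  assumes g: "has_weak_gradient v g" "L2 v" and h: "has_weak_gradient w h" "L2 w"
  shows "has_weak_gradient (\<lambda>x. v x + w x) (\<lambda>x. g x + h x)"
  unfolding has_weak_gradient_def
proof (intro conjI allI impI)
  show "L2 (\<lambda>x. g x + h x)"
    using g h by (intro L2_add) (auto simp: has_weak_gradient_def)
  fix \<psi> :: "real^'d \<Rightarrow> complex" and j
  assume \<psi>: "periodic \<psi> \<and> C1 \<psi>"
  have "L2 \<psi>" "L2 (partial_deriv j \<psi>)"
    using \<psi> C1_continuous by (auto simp: C1_def intro!: L2_continuous)
  then show "(\<integral>x. (v x + w x) * partial_deriv j \<psi> x \<partial>lebesgue_on Omega)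
      = - (\<integral>x. (g x + h x) $ j * \<psi> x \<partial>lebesgue_on Omega)"
    using g h \<psi> by (simp add: distrib_right L2_integrable_mult has_weak_gradient_L2)
      (simp add: has_weak_gradient_def)
qed

lemma has_weak_gradient_scale:
  fixes v :: "real^'d \<Rightarrow> complex"
  assumes g: "has_weak_gradient v g"
  shows "has_weak_gradient (\<lambda>x. c * v x) (\<lambda>x. c *s g x)"
  unfolding has_weak_gradient_def
proof (intro conjI allI impI)
  show "L2 (\<lambda>x. c *s g x)"
    using g by (intro L2_vec_scale) (auto simp: has_weak_gradient_def)
  fix \<psi> :: "real^'d \<Rightarrow> complex" and j
  assume "periodic \<psi> \<and> C1 \<psi>"
  then show "(\<integral>x. c * v x * partial_deriv j \<psi> x \<partial>lebesgue_on Omega)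
      = - (\<integral>x. (c *s g x) $ j * \<psi> x \<partial>lebesgue_on Omega)"
    using g by (simp add: has_weak_gradient_def mult.assoc)
qed

lemma H1p_L2: "v \<in> H1p \<Longrightarrow> L2 v"
  by (simp add: H1p_def)

lemma H1p_grad: "v \<in> H1p \<Longrightarrow> has_weak_gradient v (grad v)"
  unfolding grad_def by (rule someI_ex[of "has_weak_gradient v"]) (simp add: H1p_def)

lemma H1p_periodic: "v \<in> H1p \<Longrightarrow> periodic v"
  by (simp add: H1p_def)

lemma H1pI: "periodic v \<Longrightarrow> L2 v \<Longrightarrow> has_weak_gradient v g \<Longrightarrow> v \<in> H1p"
  by (auto simp: H1p_def)

lemma H1p_phi: "phi k \<in> H1p"
  by (rule H1pI[OF periodic_phi L2_continuous[OF continuous_phi] has_weak_gradient_phi])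

lemma H1p_add: "v \<in> H1p \<Longrightarrow> w \<in> H1p \<Longrightarrow> (\<lambda>x. v x + w x) \<in> H1p"
  using H1p_periodic[of v] H1p_periodic[of w]
  by (intro H1pI[OF _ _ has_weak_gradient_add[OF H1p_grad _ H1p_grad]] L2_add H1p_L2)
     (auto simp: periodic_def)

lemma H1p_scale: "v \<in> H1p \<Longrightarrow> (\<lambda>x. c * v x) \<in> H1p"
  using H1p_periodic[of v]
  by (intro H1pI[OF _ _ has_weak_gradient_scale[OF H1p_grad]] L2_scale H1p_L2)
     (auto simp: periodic_def)

lemma H1p_diff: "v \<in> H1p \<Longrightarrow> w \<in> H1p \<Longrightarrow> (\<lambda>x. v x - w x) \<in> H1p"
  using H1p_add[OF _ H1p_scale[of w "-1"], of v] by simp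

lemma V_sub_H1p: "v \<in> V_sub \<Lambda> \<Longrightarrow> v \<in> H1p"
proof (induction rule: V_sub_induct)
  case zero
  show ?case using H1p_scale[OF H1p_phi, of 0] by simp
next
  case (step c k v)
  show ?case by (rule H1p_add[OF H1p_scale[OF H1p_phi] step.IH])
qed

lemma grad_add:
  assumes "v \<in> H1p" "w \<in> H1p"
  shows "AE x in lebesgue_on Omega. grad (\<lambda>x. v x + w x) x = grad v x + grad w x"
  using assms by (intro has_weak_gradient_unique[OF H1p_grad has_weak_gradient_add] H1p_add H1p_grad H1p_L2)

lemma grad_scale:
  assumes "v \<in> H1p"
  shows "AE x in lebesgue_on Omega. grad (\<lambda>x. c * v x) x = c *s grad v x"
  using assms by (intro has_weak_gradient_unique[OF H1p_grad has_weak_gradient_scale] H1p_scale H1p_grad)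

lemma grad_phi:
  "AE x in lebesgue_on Omega. grad (phi k) x = (\<chi> j. \<i> * of_int (k $ j) * phi k x)"
  by (intro has_weak_gradient_unique[OF H1p_grad has_weak_gradient_phi] H1p_phi)

section \<open>Fourier coefficients and the Bessel inequality\<close>

lemma fourier_coeff_add:
  assumes "L2 v" "L2 w"
  shows "fourier_coeff (\<lambda>x. v x + w x) k = fourier_coeff v k + fourier_coeff w k"
  using assms L2_cnj[OF L2_continuous[OF continuous_phi[of k]]]
  by (simp add: fourier_coeff_def distrib_right L2_integrable_mult)

lemma fourier_coeff_scale: "fourier_coeff (\<lambda>x. c * v x) k = c * fourier_coeff v k"
  by (simp add: fourier_coeff_def mult.assoc)

lemma fourier_coeff_diff:
  assumes "L2 v" "L2 w"
  shows "fourier_coeff (\<lambda>x. v x - w x) k = fourier_coeff v k - fourier_coeff w k"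
  using fourier_coeff_add[OF assms(1) L2_scale[OF assms(2), of "-1"]]
    fourier_coeff_scale[of "-1" w] by simp

lemma fourier_coeff_phi: "fourier_coeff (phi l) k = (if k = l then 1 else 0)"
  by (auto simp: fourier_coeff_def phi_orthonormal)

lemma L2_trig: "finite F \<Longrightarrow> L2 (\<lambda>x. \<Sum>k\<in>F. c k * phi k x)"
  by (rule L2_continuous[OF V_sub_continuous[OF V_sub_sumI[OF _ subset_UNIV]]])

lemma fourier_coeff_trig:
  assumes "finite F"
  shows "fourier_coeff (\<lambda>x. \<Sum>l\<in>F. c l * phi l x) k = (if k \<in> F then c k else 0)"
  using assms
proof (induction F rule: finite_induct)
  case empty
  then show ?case by (simp add: fourier_coeff_def)
next
  case (insert l F)
  have "L2 (\<lambda>x. \<Sum>l\<in>F. c l * phi l x)"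
    by (rule L2_trig[OF insert(1)])
  with insert show ?case
    by (auto simp: fourier_coeff_add L2_scale L2_continuous continuous_phi fourier_coeff_scale fourier_coeff_phi)
qed

lemma integral_mult_cnj_trig:
  assumes v: "L2 v" and F: "finite F"
  shows "(\<integral>x. v x * cnj (\<Sum>k\<in>F. c k * phi k x) \<partial>lebesgue_on Omega) = (\<Sum>k\<in>F. fourier_coeff v k * cnj (c k))"
proof -
  have i: "integrable (lebesgue_on Omega) (\<lambda>x. v x * cnj (phi k x))" for k
    by (intro L2_integrable_mult v L2_cnj L2_continuous continuous_phi)
  have "(\<integral>x. v x * cnj (\<Sum>k\<in>F. c k * phi k x) \<partial>lebesgue_on Omega)
      = (\<integral>x. (\<Sum>k\<in>F. cnj (c k) * (v x * cnj (phi k x))) \<partial>lebesgue_on Omega)"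
    by (simp add: sum_distrib_left mult_ac)
  also have "\<dots> = (\<Sum>k\<in>F. cnj (c k) * fourier_coeff v k)"
    using i by (simp add: fourier_coeff_def)
  finally show ?thesis by (simp add: mult.commute)
qed

lemma integral_norm_trig:
  assumes F: "finite F"
  shows "(\<integral>x. (cmod (\<Sum>k\<in>F. c k * phi k x))\<^sup>2 \<partial>lebesgue_on Omega) = (\<Sum>k\<in>F. (cmod (c k))\<^sup>2)"
proof -
  let ?p = "\<lambda>x. \<Sum>k\<in>F. c k * phi k x"
  have "L2 ?p" by (rule L2_trig[OF F])
  then have "(\<integral>x. ?p x * cnj (?p x) \<partial>lebesgue_on Omega) = (\<Sum>k\<in>F. fourier_coeff ?p k * cnj (c k))"
    by (rule integral_mult_cnj_trig[OF _ F])
  then have "complex_of_real (\<integral>x. (cmod (?p x))\<^sup>2 \<partial>lebesgue_on Omega) = (\<Sum>k\<in>F. fourier_coeff ?p k * cnj (c k))"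
    by (simp only: complex_norm_square[symmetric] integral_complex_of_real)
  also have "\<dots> = of_real (\<Sum>k\<in>F. (cmod (c k))\<^sup>2)"
    using F by (simp add: fourier_coeff_trig complex_norm_square[symmetric] flip: of_real_power)
  finally show ?thesis by (simp only: of_real_eq_iff)
qed

text \<open>Expand the square in the nonnegative integral of $|v - p|^2$, where $p$ is the partial Fourier sum
  of $v$ over $F$.\<close>

lemma bessel:
  assumes v: "L2 v" and F: "finite F"
  shows "(\<Sum>k\<in>F. (cmod (fourier_coeff v k))\<^sup>2) \<le> (\<integral>x. (cmod (v x))\<^sup>2 \<partial>lebesgue_on Omega)"
proof -
  let ?M = "lebesgue_on Omega"
  let ?p = "\<lambda>x. \<Sum>k\<in>F. fourier_coeff v k * phi k x"
  let ?S = "\<Sum>k\<in>F. (cmod (fourier_coeff v k))\<^sup>2"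
  have p: "L2 ?p" by (rule L2_trig[OF F])
  have i: "integrable ?M (\<lambda>x. v x * cnj (?p x))" by (intro L2_integrable_mult v L2_cnj p)
  have "(\<integral>x. v x * cnj (?p x) \<partial>?M) = of_real ?S"
    using integral_mult_cnj_trig[OF v F, of "fourier_coeff v"]
    by (simp add: complex_norm_square[symmetric] flip: of_real_power)
  then have 1: "(\<integral>x. Re (v x * cnj (?p x)) \<partial>?M) = ?S"
    by (simp only: integral_Re[OF i] Re_complex_of_real)
  define r where "r x = Re (v x * cnj (?p x))" for x
  define q where "q x = (cmod (?p x))\<^sup>2" for x
  have r: "integrable ?M r" "integral\<^sup>L ?M r = ?S"
    unfolding r_def using 1 integrable_Re[OF i] by blast+
  have q: "integrable ?M q" "integral\<^sup>L ?M q = ?S"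
    unfolding q_def using p integral_norm_trig[OF F, of "fourier_coeff v"] by (simp_all add: L2_def)
  have e: "(cmod (a - b))\<^sup>2 = (cmod a)\<^sup>2 + (cmod b)\<^sup>2 - 2 * Re (a * cnj b)" for a b
    unfolding cmod_power2 by (simp add: power2_eq_square algebra_simps)
  have "0 \<le> (\<integral>x. (cmod (v x - ?p x))\<^sup>2 \<partial>?M)" by simp
  also have "\<dots> = (\<integral>x. (cmod (v x))\<^sup>2 + q x - 2 * r x \<partial>?M)"
    unfolding e q_def r_def by (rule refl)
  also have "\<dots> = (\<integral>x. (cmod (v x))\<^sup>2 \<partial>?M) + ?S - 2 * ?S"
    using v q r by (simp add: L2_def)
  finally show ?thesis by simp
qed

section \<open>The Sobolev norm by integrals and by coefficients\<close>

lemma norm_wave_square: "(norm (wave k))\<^sup>2 = (\<Sum>j\<in>UNIV. (real_of_int (k $ j))\<^sup>2)"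
  by (simp add: norm_vec_def L2_set_def wave_def sum_nonneg)

text \<open>The square of the $H^1$ norm written with integrals of the weak gradient. The energy form is
  compared with this expression pointwise under the integral, whereas \<open>norm_H1p\<close> is a sum over Fourier
  coefficients.\<close>

definition h1_integral :: "(real^'d \<Rightarrow> complex) \<Rightarrow> real" where
  "h1_integral v = (\<Sum>j\<in>UNIV. \<integral>x. (cmod (grad v x $ j))\<^sup>2 \<partial>lebesgue_on Omega)
     + (\<integral>x. (cmod (v x))\<^sup>2 \<partial>lebesgue_on Omega)"

lemma h1_integral_split:
  assumes v: "v \<in> H1p"
  shows "integrable (lebesgue_on Omega) (\<lambda>x. \<Sum>j\<in>UNIV. (cmod (grad v x $ j))\<^sup>2)"
    "integrable (lebesgue_on Omega) (\<lambda>x. (cmod (v x))\<^sup>2)"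
    "h1_integral v = (\<integral>x. (\<Sum>j\<in>UNIV. (cmod (grad v x $ j))\<^sup>2) \<partial>lebesgue_on Omega)
      + (\<integral>x. (cmod (v x))\<^sup>2 \<partial>lebesgue_on Omega)"
proof -
  have i: "integrable (lebesgue_on Omega) (\<lambda>x. (cmod (grad v x $ j))\<^sup>2)" for j
    using has_weak_gradient_L2[OF H1p_grad[OF v]] by (simp add: L2_def)
  then show "integrable (lebesgue_on Omega) (\<lambda>x. \<Sum>j\<in>UNIV. (cmod (grad v x $ j))\<^sup>2)"
    by (intro Bochner_Integration.integrable_sum)
  show "integrable (lebesgue_on Omega) (\<lambda>x. (cmod (v x))\<^sup>2)"
    using H1p_L2[OF v] by (simp add: L2_def)
  show "h1_integral v = (\<integral>x. (\<Sum>j\<in>UNIV. (cmod (grad v x $ j))\<^sup>2) \<partial>lebesgue_on Omega)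
      + (\<integral>x. (cmod (v x))\<^sup>2 \<partial>lebesgue_on Omega)"
    using i by (simp add: h1_integral_def)
qed

lemma weighted_sum_split:
  fixes c :: "int^'d \<Rightarrow> complex"
  shows "(\<Sum>k\<in>F. (1 + (norm (wave k))\<^sup>2) * (cmod (c k))\<^sup>2)
    = (\<Sum>j\<in>UNIV. \<Sum>k\<in>F. (cmod (\<i> * of_int (k $ j) * c k))\<^sup>2) + (\<Sum>k\<in>F. (cmod (c k))\<^sup>2)"
proof -
  have "(1 + (norm (wave k))\<^sup>2) * (cmod (c k))\<^sup>2
      = (\<Sum>j\<in>UNIV. (cmod (\<i> * of_int (k $ j) * c k))\<^sup>2) + (cmod (c k))\<^sup>2" for k :: "int^'d"
    by (simp add: norm_wave_square norm_mult power_mult_distrib sum_distrib_right[symmetric] distrib_right)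
  then show ?thesis
    by (simp add: sum.distrib) (rule sum.swap)
qed

text \<open>The Bessel inequality for \<open>v\<close> and for each component of its gradient, whose coefficients are
  $i k_j \hat v_k$.\<close>

lemma h1_integral_bessel:
  assumes v: "v \<in> H1p" and F: "finite F"
  shows "(\<Sum>k\<in>F. (1 + (norm (wave k))\<^sup>2) * (cmod (fourier_coeff v k))\<^sup>2) \<le> h1_integral v"
  unfolding weighted_sum_split h1_integral_def
proof (intro add_mono sum_mono bessel F H1p_L2[OF v])
  fix j
  show "(\<Sum>k\<in>F. (cmod (\<i> * of_int (k $ j) * fourier_coeff v k))\<^sup>2)
      \<le> (\<integral>x. (cmod (grad v x $ j))\<^sup>2 \<partial>lebesgue_on Omega)"
    using bessel[OF has_weak_gradient_L2[OF H1p_grad[OF v]] F, of j]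
    by (simp add: fourier_coeff_weak_gradient[OF H1p_grad[OF v]])
qed

lemma grad_trig:
  fixes c :: "int^'d \<Rightarrow> complex"
  assumes "finite F"
  shows "AE x in lebesgue_on Omega. \<forall>j. grad (\<lambda>x. \<Sum>k\<in>F. c k * phi k x) x $ j
    = (\<Sum>k\<in>F. (\<i> * of_int (k $ j) * c k) * phi k x)"
  using assms
proof (induction F rule: finite_induct)
  case empty
  show ?case
    using grad_scale[OF H1p_phi, of 0 0] by eventually_elim simp
next
  case (insert k F)
  have F: "(\<lambda>x. \<Sum>k\<in>F. c k * phi k x) \<in> H1p"
    by (rule V_sub_H1p[OF V_sub_sumI[OF insert(1) subset_UNIV]])
  show ?case
    using insert.IH grad_add[OF H1p_scale[OF H1p_phi[of k], of "c k"] F]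
      grad_scale[OF H1p_phi[of k], of "c k"] grad_phi[of k]
    by eventually_elim (simp add: insert.hyps mult_ac)
qed

text \<open>For trigonometric polynomials orthonormality turns the Bessel inequality into an equality.\<close>

lemma h1_integral_trig:
  assumes F: "finite F"
  shows "h1_integral (\<lambda>x. \<Sum>k\<in>F. c k * phi k x) = (\<Sum>k\<in>F. (1 + (norm (wave k))\<^sup>2) * (cmod (c k))\<^sup>2)"
proof -
  let ?p = "\<lambda>x. \<Sum>k\<in>F. c k * phi k x"
  have p: "?p \<in> H1p" by (rule V_sub_H1p[OF V_sub_sumI[OF F subset_UNIV]])
  have "(\<integral>x. (cmod (grad ?p x $ j))\<^sup>2 \<partial>lebesgue_on Omega)
      = (\<integral>x. (cmod (\<Sum>k\<in>F. (\<i> * of_int (k $ j) * c k) * phi k x))\<^sup>2 \<partial>lebesgue_on Omega)" for j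
  proof (rule integral_cong_AE)
    show "AE x in lebesgue_on Omega. (cmod (grad ?p x $ j))\<^sup>2
        = (cmod (\<Sum>k\<in>F. (\<i> * of_int (k $ j) * c k) * phi k x))\<^sup>2"
      using grad_trig[OF F, of c] by eventually_elim simp
    show "(\<lambda>x. (cmod (grad ?p x $ j))\<^sup>2) \<in> borel_measurable (lebesgue_on Omega)"
      using has_weak_gradient_L2[OF H1p_grad[OF p], of j] unfolding L2_def by (blast dest: borel_measurable_integrable)
    show "(\<lambda>x. (cmod (\<Sum>k\<in>F. (\<i> * of_int (k $ j) * c k) * phi k x))\<^sup>2) \<in> borel_measurable (lebesgue_on Omega)"
      using L2_trig[OF F, of "\<lambda>k. \<i> * of_int (k $ j) * c k"] unfolding L2_def by (blast dest: borel_measurable_integrable)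
  qed
  then show ?thesis
    by (simp only: h1_integral_def weighted_sum_split integral_norm_trig[OF F])
qed

lemma h1_integral_nonneg: "0 \<le> h1_integral v"
  by (auto simp: h1_integral_def intro!: add_nonneg_nonneg sum_nonneg)

lemma tendsto_zero_squeeze:
  fixes a b :: "nat \<Rightarrow> real"
  assumes "\<And>n. 0 \<le> a n" "\<And>n. a n \<le> b n" "b \<longlonglongrightarrow> 0"
  shows "a \<longlonglongrightarrow> 0"
  by (rule tendsto_sandwich[of "\<lambda>_. 0" a _ b 0]) (use assms in auto)

lemma nonneg_summable_onI:
  fixes a :: "'a \<Rightarrow> real"
  assumes "\<And>k. 0 \<le> a k" "\<And>F. finite F \<Longrightarrow> sum a F \<le> B"
  shows "a summable_on UNIV"
  by (rule nonneg_bdd_above_summable_on) (use assms in \<open>auto intro!: bdd_aboveI2\<close>)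

lemma H1p_summable:
  assumes "v \<in> H1p"
  shows "(\<lambda>k. (1 + (norm (wave k))\<^sup>2) * (cmod (fourier_coeff v k))\<^sup>2) summable_on UNIV"
  by (rule nonneg_summable_onI) (use h1_integral_bessel[OF assms] in auto)

lemma norm_H1p_square:
  "(norm_H1p v)\<^sup>2 = (\<Sum>\<^sub>\<infinity>k. (1 + (norm (wave k))\<^sup>2) * (cmod (fourier_coeff v k))\<^sup>2)"
  unfolding norm_H1p_def by (intro real_sqrt_pow2 infsum_nonneg) simp

lemma norm_H1p_nonneg: "0 \<le> norm_H1p v"
  unfolding norm_H1p_def by (intro real_sqrt_ge_zero infsum_nonneg) simp

lemma norm_H1p_finite_sum:
  assumes "v \<in> H1p" "finite F"
  shows "(\<Sum>k\<in>F. (1 + (norm (wave k))\<^sup>2) * (cmod (fourier_coeff v k))\<^sup>2) \<le> (norm_H1p v)\<^sup>2"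
  unfolding norm_H1p_square
  by (rule finite_sum_le_infsum[OF H1p_summable]) (use assms in auto)

lemma norm_H1p_le_h1_integral:
  assumes "v \<in> H1p"
  shows "(norm_H1p v)\<^sup>2 \<le> h1_integral v"
  unfolding norm_H1p_square
  by (rule infsum_le_finite_sums[OF H1p_summable]) (use assms h1_integral_bessel in auto)

section \<open>Pairing with a continuous function\<close>

text \<open>A Cauchy--Schwarz inequality in which the second factor is measured by Fourier coefficients. For a
  trigonometric polynomial \<open>p\<close> in place of \<open>g\<close> the integral is a finite sum over coefficients, with
  $\|p\|_{L^2}$ controlled by the supremum of \<open>p\<close>; a limit of uniform approximations \<open>p\<close> of \<open>g\<close> gives
  the claim.\<close>

lemma pairing_bound:
  fixes g :: "real^'d \<Rightarrow> complex"
  assumes per: "periodic g" and cont: "continuous_on UNIV g"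
  obtains C where "0 \<le> C"
    "\<And>v B. L2 v \<Longrightarrow> 0 \<le> B \<Longrightarrow> (\<And>F. finite F \<Longrightarrow> (\<Sum>k\<in>F. (cmod (fourier_coeff v k))\<^sup>2) \<le> B\<^sup>2)
      \<Longrightarrow> cmod (\<integral>x. g x * cnj (v x) \<partial>lebesgue_on Omega) \<le> C * B"
proof -
  let ?M = "lebesgue_on (Omega :: (real^'d) set)"
  obtain G where G: "0 \<le> G" "\<And>x. x \<in> cbox 0 (\<chi> j. 2 * pi) \<Longrightarrow> cmod (g x) \<le> G"
    using continuous_bounded_Omega[OF cont] by metis
  define V where "V = measure ?M (space ?M)"
  have V: "0 \<le> V" by (simp add: V_def)
  define C where "C = (G + 1) * sqrt V"
  have "cmod (\<integral>x. g x * cnj (v x) \<partial>?M) \<le> C * B"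
    if v: "L2 v" and B: "0 \<le> B" and sums: "\<And>F. finite F \<Longrightarrow> (\<Sum>k\<in>F. (cmod (fourier_coeff v k))\<^sup>2) \<le> B\<^sup>2"
    for v B
  proof -
    define H where "H = (\<integral>x. cmod (v x) \<partial>?M)"
    have H: "0 \<le> H" by (simp add: H_def)
    have bound: "cmod (\<integral>x. g x * cnj (v x) \<partial>?M) \<le> C * B + e * H" if e: "0 < e" "e < 1" for e
    proof -
      obtain p where p: "p \<in> V_sub UNIV" "\<And>x. cmod (g x - p x) < e"
        using trig_approx_periodic[OF per cont e(1)] by metis
      obtain F c where F: "finite F" "p = (\<lambda>x. \<Sum>k\<in>F. c k * phi k x)"
        using p(1) by (auto simp: V_sub_def)
      have pL: "L2 p" unfolding F(2) by (rule L2_trig[OF F(1)])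
      have pB: "cmod (p x) \<le> G + 1" if "x \<in> Omega" for x
      proof -
        have "cmod (p x) \<le> cmod (g x) + cmod (g x - p x)"
          by (metis norm_minus_commute norm_triangle_sub)
        moreover have "cmod (g x) \<le> G" using G(2) that Omega_subset_cube by auto
        ultimately show ?thesis using p(2)[of x] e by linarith
      qed
      have "(\<Sum>k\<in>F. (cmod (c k))\<^sup>2) = (\<integral>x. (cmod (p x))\<^sup>2 \<partial>?M)"
        unfolding F(2) by (rule integral_norm_trig[OF F(1), symmetric])
      also have "\<dots> \<le> (\<integral>x. (G + 1)\<^sup>2 \<partial>?M)"
        by (rule integral_mono) (use pL pB in \<open>auto simp: L2_def intro!: power_mono\<close>)
      also have "\<dots> = V * (G + 1)\<^sup>2" by (simp add: V_def)
      finally have c: "(\<Sum>k\<in>F. (cmod (c k))\<^sup>2) \<le> V * (G + 1)\<^sup>2" .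
      have "(\<integral>x. v x * cnj (p x) \<partial>?M) = (\<Sum>k\<in>F. fourier_coeff v k * cnj (c k))"
        unfolding F(2) by (rule integral_mult_cnj_trig[OF v F(1)])
      also have "cmod \<dots> \<le> (\<Sum>k\<in>F. \<bar>cmod (fourier_coeff v k)\<bar> * \<bar>cmod (c k)\<bar>)"
        by (rule order_trans[OF norm_sum]) (simp add: norm_mult)
      also have "\<dots> \<le> L2_set (\<lambda>k. cmod (fourier_coeff v k)) F * L2_set (\<lambda>k. cmod (c k)) F"
        by (rule L2_set_mult_ineq)
      also have "\<dots> \<le> sqrt (B\<^sup>2) * sqrt (V * (G + 1)\<^sup>2)"
        unfolding L2_set_def
        by (intro mult_mono real_sqrt_le_mono sums F c real_sqrt_ge_zero sum_nonneg) auto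
      also have "\<dots> = C * B" using B G V by (simp add: C_def real_sqrt_mult)
      finally have vp: "cmod (\<integral>x. v x * cnj (p x) \<partial>?M) \<le> C * B" .
      have "(\<integral>x. p x * cnj (v x) \<partial>?M) = cnj (\<integral>x. v x * cnj (p x) \<partial>?M)"
        by (subst Bochner_Integration.integral_cnj[symmetric]) (simp add: mult.commute)
      then have pv: "cmod (\<integral>x. p x * cnj (v x) \<partial>?M) \<le> C * B" using vp by simp
      have i: "integrable ?M (\<lambda>x. g x * cnj (v x))" "integrable ?M (\<lambda>x. p x * cnj (v x))"
        by (intro L2_integrable_mult L2_cnj v pL L2_continuous[OF cont])+
      have "cmod (\<integral>x. g x * cnj (v x) - p x * cnj (v x) \<partial>?M) \<le> (\<integral>x. e * cmod (v x) \<partial>?M)"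
      proof (rule Bochner_Integration.integral_norm_bound_integral)
        show "integrable ?M (\<lambda>x. e * cmod (v x))" using L2_integrable[OF v] by simp
        show "integrable ?M (\<lambda>x. g x * cnj (v x) - p x * cnj (v x))" using i by simp
        fix x
        have "cmod ((g x - p x) * cnj (v x)) \<le> e * cmod (v x)"
          using p(2)[of x] by (simp add: norm_mult mult_right_mono)
        then show "cmod (g x * cnj (v x) - p x * cnj (v x)) \<le> e * cmod (v x)"
          by (simp add: left_diff_distrib)
      qed
      then have "cmod ((\<integral>x. g x * cnj (v x) \<partial>?M) - (\<integral>x. p x * cnj (v x) \<partial>?M)) \<le> e * H"
        using i by (simp add: H_def)
      then show ?thesis using pv norm_triangle_sub[of "\<integral>x. g x * cnj (v x) \<partial>?M" "\<integral>x. p x * cnj (v x) \<partial>?M"]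
        by linarith
    qed
    show ?thesis
    proof (rule field_le_epsilon)
      fix d :: real assume d: "0 < d"
      \<comment> \<open>$H + 1$ avoids division by zero\<close>
    let ?e = "min (1/2) (d / (H + 1))"
      have "?e * H \<le> d / (H + 1) * H" using H by (intro mult_right_mono) auto
      also have "\<dots> \<le> d" using d H by (simp add: field_simps)
      finally show "cmod (\<integral>x. g x * cnj (v x) \<partial>?M) \<le> C * B + d"
        using bound[of ?e] d H by (simp add: min_less_iff_disj)
    qed
  qed
  moreover have "0 \<le> C" using G V by (simp add: C_def)
  ultimately show ?thesis using that by blast
qed

section \<open>Bounded functionals\<close>

lemma Hm1p_add: "f \<in> Hm1p \<Longrightarrow> v \<in> H1p \<Longrightarrow> w \<in> H1p \<Longrightarrow> f (\<lambda>x. v x + w x) = f v + f w"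
  by (simp add: Hm1p_def)

lemma Hm1p_scale: "f \<in> Hm1p \<Longrightarrow> v \<in> H1p \<Longrightarrow> f (\<lambda>x. c * v x) = cnj c * f v"
  by (simp add: Hm1p_def)

lemma Hm1p_diff:
  assumes "f \<in> Hm1p" "v \<in> H1p" "w \<in> H1p"
  shows "f (\<lambda>x. v x - w x) = f v - f w"
  using Hm1p_add[OF assms(1,2) H1p_scale[OF assms(3)], of "-1"] Hm1p_scale[OF assms(1,3), of "-1"] by simp

lemma Hm1p_trig:
  assumes f: "f \<in> Hm1p" and "finite F"
  shows "f (\<lambda>x. \<Sum>k\<in>F. c k * phi k x) = (\<Sum>k\<in>F. cnj (c k) * f (phi k))"
  using assms(2)
proof (induction F rule: finite_induct)
  case empty
  show ?case using Hm1p_scale[OF f H1p_phi, of 0 0] by simp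
next
  case (insert k F)
  have "(\<lambda>x. \<Sum>k\<in>F. c k * phi k x) \<in> H1p"
    by (rule V_sub_H1p[OF V_sub_sumI[OF insert(1) subset_UNIV]])
  then show ?case
    using insert by (simp add: Hm1p_add[OF f H1p_scale[OF H1p_phi]] Hm1p_scale[OF f H1p_phi])
qed

lemma norm_H1p_tail:
  assumes v: "v \<in> H1p" and d: "0 < d"
  obtains F where "finite F" "norm_H1p (\<lambda>x. v x - (\<Sum>k\<in>F. fourier_coeff v k * phi k x)) \<le> d"
proof -
  let ?a = "\<lambda>k. (1 + (norm (wave k))\<^sup>2) * (cmod (fourier_coeff v k))\<^sup>2"
  obtain F where F: "finite F" "dist (sum ?a F) (infsum ?a UNIV) \<le> d\<^sup>2"
    using infsum_finite_approximation[OF H1p_summable[OF v], of "d\<^sup>2"] d by auto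
  let ?w = "\<lambda>x. v x - (\<Sum>k\<in>F. fourier_coeff v k * phi k x)"
  have w: "fourier_coeff ?w k = (if k \<in> F then 0 else fourier_coeff v k)" for k
    using F(1) by (simp add: fourier_coeff_diff H1p_L2[OF v] L2_trig fourier_coeff_trig)
  have "(norm_H1p ?w)\<^sup>2 = infsum ?a (- F)"
    unfolding norm_H1p_square w by (rule infsum_cong_neutral) auto
  also have "\<dots> = infsum ?a UNIV - sum ?a F"
    using infsum_Diff[OF H1p_summable[OF v], of F] F(1) by (simp add: Compl_eq_Diff_UNIV)
  also have "\<dots> \<le> d\<^sup>2" using F(2) by (simp add: dist_real_def)
  finally have "norm_H1p ?w \<le> d" using d by (auto intro: power2_le_imp_le)
  then show ?thesis using that F(1) by blast
qed

text \<open>A functional is bounded with respect to \<open>norm_H1p\<close>, and in this norm the partial Fourier sums of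
  \<open>v\<close> converge to \<open>v\<close> as tails of a convergent series. Hence the functional is determined by its
  values on the basis functions.\<close>

lemma Hm1p_expansion:
  assumes f: "f \<in> Hm1p" and v: "v \<in> H1p" and d: "0 < d"
  obtains F where "finite F" "cmod (f v - (\<Sum>k\<in>F. cnj (fourier_coeff v k) * f (phi k))) \<le> d"
proof -
  obtain C where C: "\<And>w. w \<in> H1p \<Longrightarrow> cmod (f w) \<le> C * norm_H1p w"
    using f unfolding Hm1p_def by blast
  obtain F where F: "finite F" "norm_H1p (\<lambda>x. v x - (\<Sum>k\<in>F. fourier_coeff v k * phi k x)) \<le> d / (\<bar>C\<bar> + 1)"
    using norm_H1p_tail[OF v, of "d / (\<bar>C\<bar> + 1)"] d by auto
  let ?p = "\<lambda>x. \<Sum>k\<in>F. fourier_coeff v k * phi k x"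
  have p: "?p \<in> H1p" by (rule V_sub_H1p[OF V_sub_sumI[OF F(1) subset_UNIV]])
  have "f v - (\<Sum>k\<in>F. cnj (fourier_coeff v k) * f (phi k)) = f (\<lambda>x. v x - ?p x)"
    by (simp add: Hm1p_diff[OF f v p] Hm1p_trig[OF f F(1)])
  also have "cmod \<dots> \<le> C * norm_H1p (\<lambda>x. v x - ?p x)"
    by (rule C[OF H1p_diff[OF v p]])
  also have "\<dots> \<le> (\<bar>C\<bar> + 1) * (d / (\<bar>C\<bar> + 1))"
    using F(2) by (intro mult_mono) (auto simp: norm_H1p_nonneg)
  also have "\<dots> = d" by simp
  finally show ?thesis using that F(1) by blast
qed

lemma norm_Hm1p_square:
  "(norm_Hm1p f)\<^sup>2 = (\<Sum>\<^sub>\<infinity>k. (cmod (dual_coeff f k))\<^sup>2 / (1 + (norm (wave k))\<^sup>2))"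
  unfolding norm_Hm1p_def by (intro real_sqrt_pow2 infsum_nonneg) simp

lemma norm_Hm1p_nonneg: "0 \<le> norm_Hm1p f"
  unfolding norm_Hm1p_def by (intro real_sqrt_ge_zero infsum_nonneg) simp

text \<open>By orthonormality, projection to \<open>\<Lambda>\<close> keeps the coefficients in \<open>\<Lambda>\<close> and deletes all
  others.\<close>

lemma norm_Hm1p_proj:
  assumes "finite \<Lambda>"
  shows "(norm_Hm1p (proj \<Lambda> f))\<^sup>2 = (\<Sum>k\<in>\<Lambda>. (cmod (f (phi k)))\<^sup>2 / (1 + (norm (wave k))\<^sup>2))"
proof -
  have "dual_coeff (proj \<Lambda> f) k = (if k \<in> \<Lambda> then f (phi k) else 0)" for k
    using assms by (simp add: dual_coeff_def proj_def fourier_coeff_phi if_distrib sum.delta cong: if_cong)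
  then have "(norm_Hm1p (proj \<Lambda> f))\<^sup>2
      = (\<Sum>\<^sub>\<infinity>k\<in>\<Lambda>. (cmod (f (phi k)))\<^sup>2 / (1 + (norm (wave k))\<^sup>2))"
    unfolding norm_Hm1p_square by (intro infsum_cong_neutral) auto
  then show ?thesis using assms by simp
qed

section \<open>The energy form\<close>

text \<open>The bounds \<open>\<alpha>\<close> and \<open>\<beta>\<close> are common to both coefficients; they are the coercivity and continuity
  constants of the form.\<close>

locale elliptic_coefficients =
  fixes \<nu> \<sigma> :: "real^'d \<Rightarrow> real" and \<alpha> \<beta> :: real
  assumes cont_\<nu>: "continuous_on UNIV \<nu>" and cont_\<sigma>: "continuous_on UNIV \<sigma>"
    and per_\<nu>: "periodic \<nu>" and per_\<sigma>: "periodic \<sigma>"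
    and \<alpha>_pos: "0 < \<alpha>"
    and \<alpha>_\<nu>: "\<alpha> \<le> \<nu> x" and \<alpha>_\<sigma>: "\<alpha> \<le> \<sigma> x"
    and \<nu>_\<beta>: "\<nu> x \<le> \<beta>" and \<sigma>_\<beta>: "\<sigma> x \<le> \<beta>"
begin

abbreviation a where "a \<equiv> bform \<nu> \<sigma>"

definition energy :: "(real^'d \<Rightarrow> complex) \<Rightarrow> real" where
  "energy v = Re (a v v)"

lemma \<beta>_pos: "0 < \<beta>"
  using \<alpha>_pos \<alpha>_\<nu> \<nu>_\<beta> by (meson less_le_trans)

lemma integrable_grad_product:
  assumes v: "v \<in> H1p" and w: "w \<in> H1p"
  shows "integrable (lebesgue_on Omega) (\<lambda>x. of_real (\<nu> x) * (\<Sum>j\<in>UNIV. grad v x $ j * cnj (grad w x $ j)))"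
proof -
  have "integrable (lebesgue_on Omega) (\<lambda>x. \<Sum>j\<in>UNIV. of_real (\<nu> x) * grad v x $ j * cnj (grad w x $ j))"
    by (intro Bochner_Integration.integrable_sum integrable_weighted cont_\<nu>
        has_weak_gradient_L2[OF H1p_grad[OF v]] has_weak_gradient_L2[OF H1p_grad[OF w]])
  then show ?thesis by (simp add: sum_distrib_left mult.assoc)
qed

lemma integrable_product:
  assumes v: "v \<in> H1p" and w: "w \<in> H1p"
  shows "integrable (lebesgue_on Omega) (\<lambda>x. of_real (\<sigma> x) * v x * cnj (w x))"
  by (intro integrable_weighted cont_\<sigma> H1p_L2 v w)

text \<open>The gradient of a sum is the sum of the gradients only almost everywhere, hence the congruence
  under the integral.\<close>

lemma bform_add_left:
  assumes v: "v \<in> H1p" and w: "w \<in> H1p" and z: "z \<in> H1p"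
  shows "a (\<lambda>x. v x + w x) z = a v z + a w z"
proof -
  let ?M = "lebesgue_on (Omega :: (real^'d) set)"
  note vw = H1p_add[OF v w]
  have "(\<integral>x. of_real (\<nu> x) * (\<Sum>j\<in>UNIV. grad (\<lambda>x. v x + w x) x $ j * cnj (grad z x $ j)) \<partial>?M)
      = (\<integral>x. of_real (\<nu> x) * (\<Sum>j\<in>UNIV. grad v x $ j * cnj (grad z x $ j))
          + of_real (\<nu> x) * (\<Sum>j\<in>UNIV. grad w x $ j * cnj (grad z x $ j)) \<partial>?M)"
  proof (rule integral_cong_AE)
    show "AE x in ?M. of_real (\<nu> x) * (\<Sum>j\<in>UNIV. grad (\<lambda>x. v x + w x) x $ j * cnj (grad z x $ j))
      = of_real (\<nu> x) * (\<Sum>j\<in>UNIV. grad v x $ j * cnj (grad z x $ j))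
          + of_real (\<nu> x) * (\<Sum>j\<in>UNIV. grad w x $ j * cnj (grad z x $ j))"
      using grad_add[OF v w]
      by eventually_elim (simp add: distrib_right distrib_left sum.distrib)
  qed (intro borel_measurable_integrable Bochner_Integration.integrable_add integrable_grad_product v w z vw)+
  then show ?thesis
    using integrable_grad_product[OF v z] integrable_grad_product[OF w z]
      integrable_product[OF v z] integrable_product[OF w z]
    by (simp add: bform_def distrib_right distrib_left mult.assoc)
qed

lemma bform_scale_left:
  assumes v: "v \<in> H1p" and z: "z \<in> H1p"
  shows "a (\<lambda>x. c * v x) z = c * a v z"
proof -
  let ?M = "lebesgue_on (Omega :: (real^'d) set)"
  have "(\<integral>x. of_real (\<nu> x) * (\<Sum>j\<in>UNIV. grad (\<lambda>x. c * v x) x $ j * cnj (grad z x $ j)) \<partial>?M)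
      = (\<integral>x. c * (of_real (\<nu> x) * (\<Sum>j\<in>UNIV. grad v x $ j * cnj (grad z x $ j))) \<partial>?M)"
  proof (rule integral_cong_AE)
    show "AE x in ?M. of_real (\<nu> x) * (\<Sum>j\<in>UNIV. grad (\<lambda>x. c * v x) x $ j * cnj (grad z x $ j))
      = c * (of_real (\<nu> x) * (\<Sum>j\<in>UNIV. grad v x $ j * cnj (grad z x $ j)))"
      using grad_scale[OF v, of c]
      by eventually_elim (simp add: sum_distrib_left mult_ac)
  qed (intro borel_measurable_integrable integrable_mult_right integrable_grad_product H1p_scale v z)+
  moreover have "(\<integral>x. of_real (\<sigma> x) * (c * v x) * cnj (z x) \<partial>?M)
      = (\<integral>x. c * (of_real (\<sigma> x) * v x * cnj (z x)) \<partial>?M)"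
    by (simp add: mult_ac)
  ultimately show ?thesis
    by (simp add: bform_def distrib_left)
qed

lemma bform_cnj: "a w v = cnj (a v w)"
  unfolding bform_def complex_cnj_add
  by (simp only: Bochner_Integration.integral_cnj[symmetric] complex_cnj_mult cnj_sum complex_cnj_cnj complex_cnj_complex_of_real)
     (simp add: mult_ac)

lemma bform_add_right:
  assumes "v \<in> H1p" "w \<in> H1p" "z \<in> H1p"
  shows "a z (\<lambda>x. v x + w x) = a z v + a z w"
  using bform_add_left[OF assms] by (subst (1 2 3) bform_cnj) simp

lemma bform_scale_right:
  assumes "v \<in> H1p" "z \<in> H1p"
  shows "a z (\<lambda>x. c * v x) = cnj c * a z v"
  using bform_scale_left[OF assms] by (subst (1 2) bform_cnj) simp

lemma bform_diff_left:
  assumes "v \<in> H1p" "w \<in> H1p" "z \<in> H1p"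
  shows "a (\<lambda>x. v x - w x) z = a v z - a w z"
  using bform_add_left[OF assms(1) H1p_scale[OF assms(2)] assms(3), of "-1"]
    bform_scale_left[OF assms(2,3), of "-1"] by simp

lemma bform_trig_right:
  assumes z: "z \<in> H1p" and "finite F"
  shows "a z (\<lambda>x. \<Sum>k\<in>F. c k * phi k x) = (\<Sum>k\<in>F. cnj (c k) * a z (phi k))"
  using assms(2)
proof (induction F rule: finite_induct)
  case empty
  show ?case using bform_scale_right[OF H1p_phi z, of 0 0] by simp
next
  case (insert k F)
  have "(\<lambda>x. \<Sum>k\<in>F. c k * phi k x) \<in> H1p"
    by (rule V_sub_H1p[OF V_sub_sumI[OF insert(1) subset_UNIV]])
  then show ?case
    using insert by (simp add: bform_add_right[OF H1p_scale[OF H1p_phi] _ z] bform_scale_right[OF H1p_phi z])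
qed

lemma bform_self: "a v v = of_real (energy v)"
  using bform_cnj[of v v] by (simp add: energy_def complex_eq_iff)

lemma energy_integral:
  assumes v: "v \<in> H1p"
  shows "integrable (lebesgue_on Omega) (\<lambda>x. \<nu> x * (\<Sum>j\<in>UNIV. (cmod (grad v x $ j))\<^sup>2))"
    "integrable (lebesgue_on Omega) (\<lambda>x. \<sigma> x * (cmod (v x))\<^sup>2)"
    "energy v = (\<integral>x. \<nu> x * (\<Sum>j\<in>UNIV. (cmod (grad v x $ j))\<^sup>2) \<partial>lebesgue_on Omega)
      + (\<integral>x. \<sigma> x * (cmod (v x))\<^sup>2 \<partial>lebesgue_on Omega)"
proof -
  have e1: "of_real (\<nu> x) * (\<Sum>j\<in>UNIV. grad v x $ j * cnj (grad v x $ j))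
      = complex_of_real (\<nu> x * (\<Sum>j\<in>UNIV. (cmod (grad v x $ j))\<^sup>2))" for x
    by (simp only: complex_norm_square[symmetric] of_real_sum of_real_mult)
  have e2: "of_real (\<sigma> x) * v x * cnj (v x) = complex_of_real (\<sigma> x * (cmod (v x))\<^sup>2)" for x
    by (simp only: complex_norm_square mult.assoc of_real_mult)
  show i: "integrable (lebesgue_on Omega) (\<lambda>x. \<nu> x * (\<Sum>j\<in>UNIV. (cmod (grad v x $ j))\<^sup>2))"
    "integrable (lebesgue_on Omega) (\<lambda>x. \<sigma> x * (cmod (v x))\<^sup>2)"
    using integrable_grad_product[OF v v] integrable_product[OF v v]
    unfolding e1 e2 complex_of_real_integrable_eq .
  show "energy v = (\<integral>x. \<nu> x * (\<Sum>j\<in>UNIV. (cmod (grad v x $ j))\<^sup>2) \<partial>lebesgue_on Omega)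
      + (\<integral>x. \<sigma> x * (cmod (v x))\<^sup>2 \<partial>lebesgue_on Omega)"
    unfolding energy_def bform_def e1 e2 integral_complex_of_real
    by (simp only: of_real_add[symmetric] Re_complex_of_real)
qed

lemma energy_coercive:
  assumes v: "v \<in> H1p"
  shows "\<alpha> * h1_integral v \<le> energy v"
proof -
  have "\<alpha> * h1_integral v = (\<integral>x. \<alpha> * (\<Sum>j\<in>UNIV. (cmod (grad v x $ j))\<^sup>2) \<partial>lebesgue_on Omega)
      + (\<integral>x. \<alpha> * (cmod (v x))\<^sup>2 \<partial>lebesgue_on Omega)"
    by (simp add: h1_integral_split[OF v] distrib_left)
  also have "\<dots> \<le> energy v"
    unfolding energy_integral(3)[OF v]
    by (intro add_mono integral_mono energy_integral h1_integral_split integrable_mult_right mult_right_mono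
        \<alpha>_\<nu> \<alpha>_\<sigma> v sum_nonneg) auto
  finally show ?thesis .
qed

lemma energy_bounded:
  assumes v: "v \<in> H1p"
  shows "energy v \<le> \<beta> * h1_integral v"
proof -
  have "energy v \<le> (\<integral>x. \<beta> * (\<Sum>j\<in>UNIV. (cmod (grad v x $ j))\<^sup>2) \<partial>lebesgue_on Omega)
      + (\<integral>x. \<beta> * (cmod (v x))\<^sup>2 \<partial>lebesgue_on Omega)"
    unfolding energy_integral(3)[OF v]
    by (intro add_mono integral_mono energy_integral h1_integral_split integrable_mult_right mult_right_mono
        \<nu>_\<beta> \<sigma>_\<beta> v sum_nonneg) auto
  also have "\<dots> = \<beta> * h1_integral v"
    by (simp add: h1_integral_split[OF v] distrib_left)
  finally show ?thesis .
qed

lemma energy_nonneg: "v \<in> H1p \<Longrightarrow> 0 \<le> energy v"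
  using energy_coercive[of v] h1_integral_nonneg[of v] \<alpha>_pos
  by (meson mult_nonneg_nonneg less_imp_le order_trans)

lemma norm_H1p_le_energy:
  assumes "v \<in> H1p"
  shows "\<alpha> * (norm_H1p v)\<^sup>2 \<le> energy v"
  using mult_left_mono[OF norm_H1p_le_h1_integral[OF assms] less_imp_le[OF \<alpha>_pos]]
    energy_coercive[OF assms] by (rule order_trans)

lemma energy_add:
  assumes v: "v \<in> H1p" and w: "w \<in> H1p"
  shows "energy (\<lambda>x. v x + w x) = energy v + 2 * Re (a v w) + energy w"
proof -
  have "Re (a w v) = Re (a v w)" by (subst bform_cnj) simp
  then show ?thesis
    unfolding energy_def
    by (simp add: bform_add_left[OF v w H1p_add[OF v w]] bform_add_right[OF v w v] bform_add_right[OF v w w])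
qed

lemma energy_scale_real:
  assumes v: "v \<in> H1p"
  shows "energy (\<lambda>x. complex_of_real t * v x) = t\<^sup>2 * energy v"
  unfolding energy_def
  by (simp add: bform_scale_left[OF v H1p_scale[OF v]] bform_scale_right[OF v v] power2_eq_square)

section \<open>Equivalence of residual and error\<close>

text \<open>With \<open>phi k\<close> in the first argument, the form is a sum of integrals of $\overline{\partial_j v}$ and
  $\overline v$ against the fixed continuous periodic functions $\nu \phi_k$ and $\sigma \phi_k$. The
  coefficients of $\partial_j v$ and of $v$ are square-summable with sum at most the square of
  \<open>norm_H1p v\<close>.\<close>

lemma bform_phi_bounded: "\<exists>C. \<forall>v\<in>H1p. cmod (a (phi k) v) \<le> C * norm_H1p v"
proof -
  let ?M = "lebesgue_on (Omega :: (real^'d) set)"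
  have perm: "periodic (\<lambda>x. of_real (c x) * phi k x)" if "periodic c" for c :: "real^'d \<Rightarrow> real"
    using that periodic_phi[of k] by (simp add: periodic_def)
  have contm: "continuous_on UNIV (\<lambda>x. of_real (c x) * phi k x)" if "continuous_on UNIV c" for c :: "real^'d \<Rightarrow> real"
    using that by (intro continuous_intros continuous_phi)
  obtain C1 where C1: "0 \<le> C1" "\<And>v B. L2 v \<Longrightarrow> 0 \<le> B \<Longrightarrow> (\<And>F. finite F \<Longrightarrow> (\<Sum>k\<in>F. (cmod (fourier_coeff v k))\<^sup>2) \<le> B\<^sup>2)
      \<Longrightarrow> cmod (\<integral>x. of_real (\<nu> x) * phi k x * cnj (v x) \<partial>?M) \<le> C1 * B"
    using pairing_bound[OF perm[OF per_\<nu>] contm[OF cont_\<nu>]] by blast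
  obtain C2 where C2: "0 \<le> C2" "\<And>v B. L2 v \<Longrightarrow> 0 \<le> B \<Longrightarrow> (\<And>F. finite F \<Longrightarrow> (\<Sum>k\<in>F. (cmod (fourier_coeff v k))\<^sup>2) \<le> B\<^sup>2)
      \<Longrightarrow> cmod (\<integral>x. of_real (\<sigma> x) * phi k x * cnj (v x) \<partial>?M) \<le> C2 * B"
    using pairing_bound[OF perm[OF per_\<sigma>] contm[OF cont_\<sigma>]] by blast
  have "cmod (a (phi k) v) \<le> ((\<Sum>j\<in>UNIV. \<bar>of_int (k $ j)\<bar> * C1) + C2) * norm_H1p v" if v: "v \<in> H1p" for v
  proof -
    note gL = has_weak_gradient_L2[OF H1p_grad[OF v]]
    let ?N = "norm_H1p v"
    have sums: "(\<Sum>l\<in>F. (cmod (fourier_coeff v l))\<^sup>2) \<le> ?N\<^sup>2"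
      "(\<Sum>l\<in>F. (cmod (fourier_coeff (\<lambda>x. grad v x $ j) l))\<^sup>2) \<le> ?N\<^sup>2" if "finite F" for F j
    proof -
      have "(cmod (fourier_coeff v l))\<^sup>2 \<le> (1 + (norm (wave l))\<^sup>2) * (cmod (fourier_coeff v l))\<^sup>2" for l :: "int^'d"
        by (simp add: distrib_right)
      then show "(\<Sum>l\<in>F. (cmod (fourier_coeff v l))\<^sup>2) \<le> ?N\<^sup>2"
        by (intro order_trans[OF sum_mono norm_H1p_finite_sum[OF v that]])
      have "(real_of_int (l $ j))\<^sup>2 \<le> 1 + (norm (wave l))\<^sup>2" for l :: "int^'d"
        unfolding norm_wave_square by (rule order_trans[OF member_le_sum[of j UNIV]]) auto
      then have "(cmod (fourier_coeff (\<lambda>x. grad v x $ j) l))\<^sup>2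
          \<le> (1 + (norm (wave l))\<^sup>2) * (cmod (fourier_coeff v l))\<^sup>2" for l :: "int^'d"
        by (simp add: fourier_coeff_weak_gradient[OF H1p_grad[OF v]] norm_mult power_mult_distrib mult_right_mono)
      then show "(\<Sum>l\<in>F. (cmod (fourier_coeff (\<lambda>x. grad v x $ j) l))\<^sup>2) \<le> ?N\<^sup>2"
        by (intro order_trans[OF sum_mono norm_H1p_finite_sum[OF v that]])
    qed
    have i: "integrable ?M (\<lambda>x. of_real (\<nu> x) * phi k x * cnj (grad v x $ j))" for j
      by (intro integrable_weighted cont_\<nu> gL L2_continuous continuous_phi)
    have "(\<integral>x. of_real (\<nu> x) * (\<Sum>j\<in>UNIV. grad (phi k) x $ j * cnj (grad v x $ j)) \<partial>?M)
        = (\<integral>x. (\<Sum>j\<in>UNIV. (\<i> * of_int (k $ j)) * (of_real (\<nu> x) * phi k x * cnj (grad v x $ j))) \<partial>?M)"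
    proof (rule integral_cong_AE)
      show "AE x in ?M. of_real (\<nu> x) * (\<Sum>j\<in>UNIV. grad (phi k) x $ j * cnj (grad v x $ j))
          = (\<Sum>j\<in>UNIV. (\<i> * of_int (k $ j)) * (of_real (\<nu> x) * phi k x * cnj (grad v x $ j)))"
        using grad_phi[of k] by eventually_elim (simp add: sum_distrib_left mult_ac)
    qed (intro borel_measurable_integrable integrable_grad_product H1p_phi v
        Bochner_Integration.integrable_sum integrable_mult_right i)+
    also have "\<dots> = (\<Sum>j\<in>UNIV. (\<i> * of_int (k $ j)) * (\<integral>x. of_real (\<nu> x) * phi k x * cnj (grad v x $ j) \<partial>?M))"
      using i by simp
    finally have e: "a (phi k) v
        = (\<Sum>j\<in>UNIV. (\<i> * of_int (k $ j)) * (\<integral>x. of_real (\<nu> x) * phi k x * cnj (grad v x $ j) \<partial>?M))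
          + (\<integral>x. of_real (\<sigma> x) * phi k x * cnj (v x) \<partial>?M)"
      by (simp add: bform_def)
    have "cmod (a (phi k) v) \<le> (\<Sum>j\<in>UNIV. \<bar>of_int (k $ j)\<bar> * (C1 * ?N)) + C2 * ?N"
      unfolding e
    proof (intro order_trans[OF norm_triangle_ineq] add_mono order_trans[OF norm_sum] sum_mono)
      fix j
      have "cmod (\<integral>x. of_real (\<nu> x) * phi k x * cnj (grad v x $ j) \<partial>?M) \<le> C1 * ?N"
        by (rule C1(2)[OF gL norm_H1p_nonneg sums(2)])
      then show "cmod ((\<i> * of_int (k $ j)) * (\<integral>x. of_real (\<nu> x) * phi k x * cnj (grad v x $ j) \<partial>?M))
          \<le> \<bar>of_int (k $ j)\<bar> * (C1 * ?N)"
        by (simp add: norm_mult mult_left_mono)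
      show "cmod (\<integral>x. of_real (\<sigma> x) * phi k x * cnj (v x) \<partial>?M) \<le> C2 * ?N"
        by (rule C2(2)[OF H1p_L2[OF v] norm_H1p_nonneg sums(1)])
    qed
    then show ?thesis by (simp add: sum_distrib_right distrib_right mult.assoc)
  qed
  then show ?thesis by blast
qed

lemma bform_V_sub_bounded:
  assumes "w \<in> V_sub UNIV"
  shows "\<exists>C. \<forall>v\<in>H1p. cmod (a w v) \<le> C * norm_H1p v"
  using assms
proof (induction rule: V_sub_induct)
  case zero
  have "a (\<lambda>x. 0) v = 0" if "v \<in> H1p" for v
    using bform_scale_left[OF H1p_phi that, of 0 0] by simp
  then show ?case by (intro exI[of _ 0]) simp
next
  case (step c k w)
  obtain C where C: "\<And>v. v \<in> H1p \<Longrightarrow> cmod (a w v) \<le> C * norm_H1p v"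
    using step.IH by blast
  obtain B where B: "\<And>v. v \<in> H1p \<Longrightarrow> cmod (a (phi k) v) \<le> B * norm_H1p v"
    using bform_phi_bounded[of k] by blast
  have "cmod (a (\<lambda>x. c * phi k x + w x) v) \<le> (cmod c * B + C) * norm_H1p v" if v: "v \<in> H1p" for v
  proof -
    have "a (\<lambda>x. c * phi k x + w x) v = c * a (phi k) v + a w v"
      using bform_add_left[OF H1p_scale[OF H1p_phi] V_sub_H1p[OF step.hyps(1)] v]
        bform_scale_left[OF H1p_phi v] by simp
    also have "cmod \<dots> \<le> cmod c * cmod (a (phi k) v) + cmod (a w v)"
      by (rule order_trans[OF norm_triangle_ineq]) (simp add: norm_mult)
    also have "\<dots> \<le> cmod c * (B * norm_H1p v) + C * norm_H1p v"
      by (intro add_mono mult_left_mono B C v) simp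
    finally show ?thesis by (simp add: algebra_simps)
  qed
  then show ?case by blast
qed

text \<open>The selection of frequencies is specified only for residuals in $H^{-1}$, so membership has to be
  verified in every step. As the approximations are trigonometric polynomials, it follows from the
  bound for single basis functions.\<close>

lemma residual_Hm1p:
  assumes f: "f \<in> Hm1p" and w: "w \<in> V_sub \<Lambda>"
  shows "residual \<nu> \<sigma> f w \<in> Hm1p"
proof -
  have wH: "w \<in> H1p" by (rule V_sub_H1p[OF w])
  obtain C where C: "\<And>v. v \<in> H1p \<Longrightarrow> cmod (a w v) \<le> C * norm_H1p v"
    using bform_V_sub_bounded V_sub_mono[of \<Lambda> UNIV] w by blast
  obtain B where B: "\<And>v. v \<in> H1p \<Longrightarrow> cmod (f v) \<le> B * norm_H1p v"
    using f unfolding Hm1p_def by blast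
  have "cmod (f v - a w v) \<le> (B + C) * norm_H1p v" if "v \<in> H1p" for v
    using norm_triangle_ineq4[of "f v" "a w v"] B[OF that] C[OF that] by (simp add: distrib_right)
  then have "\<exists>C. \<forall>v\<in>H1p. cmod (f v - a w v) \<le> C * norm_H1p v" by blast
  then show ?thesis
    unfolding Hm1p_def residual_def L_op_def
    by (auto simp: Hm1p_add[OF f] Hm1p_scale[OF f] bform_add_right[OF _ _ wH] bform_scale_right[OF _ wH]
        algebra_simps)
qed

text \<open>The left-hand side is $\|P_F Lw\|^2$. It equals $a(w, z)$ and also $\|z\|^2$, where
  $z = \sum_{k \in F} (1 + |k|^2)^{-1} a(w, \phi_k) \phi_k$ is the Riesz representative of $P_F Lw$.
  As $a(z, z) \le \beta \|z\|^2$, nonnegativity of the energy of $w - z / \beta$ gives the estimate.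
  This is the continuity half of the equivalence of residual and error.\<close>

lemma dual_sum_le_energy:
  assumes w: "w \<in> H1p" and F: "finite F"
  shows "(\<Sum>k\<in>F. (cmod (a w (phi k)))\<^sup>2 / (1 + (norm (wave k))\<^sup>2)) \<le> \<beta> * energy w"
proof -
  define S where "S = (\<Sum>k\<in>F. (cmod (a w (phi k)))\<^sup>2 / (1 + (norm (wave k))\<^sup>2))"
  define c where "c k = a w (phi k) / of_real (1 + (norm (wave k))\<^sup>2)" for k
  define z where "z = (\<lambda>x. \<Sum>k\<in>F. c k * phi k x)"
  have z: "z \<in> H1p" unfolding z_def by (rule V_sub_H1p[OF V_sub_sumI[OF F subset_UNIV]])
  have pos: "0 < 1 + (norm (wave k))\<^sup>2" for k :: "int^'d"
    by (rule add_pos_nonneg) auto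
  have "cnj (c k) * a w (phi k) = of_real ((cmod (a w (phi k)))\<^sup>2 / (1 + (norm (wave k))\<^sup>2))" for k
    unfolding c_def of_real_divide complex_norm_square by (simp add: mult.commute)
  then have awz: "a w z = of_real S"
    by (simp add: z_def bform_trig_right[OF w F] S_def del: of_real_divide)
  have "(1 + (norm (wave k))\<^sup>2) * (cmod (c k))\<^sup>2 = (cmod (a w (phi k)))\<^sup>2 / (1 + (norm (wave k))\<^sup>2)" for k
    using pos[of k] by (simp add: c_def norm_divide power_divide power2_eq_square del: of_real_add)
  then have "h1_integral z = S" by (simp add: z_def h1_integral_trig[OF F] S_def)
  then have zE: "energy z \<le> \<beta> * S" using energy_bounded[OF z] by simp
  \<comment> \<open>this \<open>t\<close> minimizes $2 t S + t^2 \beta S$\<close>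
  define t where "t = - 1 / \<beta>"
  have "0 \<le> energy (\<lambda>x. w x + complex_of_real t * z x)"
    by (intro energy_nonneg H1p_add H1p_scale w z)
  also have "\<dots> = energy w + 2 * (t * S) + t\<^sup>2 * energy z"
    by (simp add: energy_add[OF w H1p_scale[OF z]] energy_scale_real[OF z] bform_scale_right[OF z w] awz)
  also have "\<dots> \<le> energy w + 2 * (t * S) + t\<^sup>2 * (\<beta> * S)"
    using zE by (intro add_left_mono mult_left_mono) auto
  also have "\<dots> = energy w - S / \<beta>"
    using \<beta>_pos by (simp add: t_def power2_eq_square field_simps)
  finally have "S / \<beta> \<le> energy w" by simp
  then show ?thesis
    using \<beta>_pos by (simp add: S_def[symmetric] pos_divide_le_eq mult.commute)
qed

lemma residual_summable:
  assumes e: "e \<in> H1p" and r: "\<And>v. v \<in> H1p \<Longrightarrow> r v = a e v"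
  shows "(\<lambda>k. (cmod (dual_coeff r k))\<^sup>2 / (1 + (norm (wave k))\<^sup>2)) summable_on UNIV"
  by (rule nonneg_summable_onI)
     (use dual_sum_le_energy[OF e] in \<open>auto simp: dual_coeff_def r H1p_phi\<close>)

lemma residual_le_energy:
  assumes e: "e \<in> H1p" and r: "\<And>v. v \<in> H1p \<Longrightarrow> r v = a e v"
  shows "(norm_Hm1p r)\<^sup>2 \<le> \<beta> * energy e"
  unfolding norm_Hm1p_square
  by (rule infsum_le_finite_sums[OF residual_summable[OF assms]])
     (use dual_sum_le_energy[OF e] in \<open>auto simp: dual_coeff_def r H1p_phi\<close>)

text \<open>The coercivity half of the equivalence of residual and error. Up to an arbitrarily small error,
  $a(e, e) = \langle r, e \rangle$ is a finite sum $\sum_k \overline{\hat e_k} \hat r_k$. Young's inequality,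
  weighted by $\alpha (1 + |k|^2)$, bounds it by $\|r\|^2 / (2 \alpha)$ plus $\alpha/2$ times a partial
  sum for $\|e\|^2$, and the latter is at most $a(e, e) / 2$ by Bessel and coercivity.\<close>

lemma energy_le_residual:
  assumes e: "e \<in> H1p" and rH: "r \<in> Hm1p" and r: "\<And>v. v \<in> H1p \<Longrightarrow> r v = a e v"
  shows "\<alpha> * energy e \<le> (norm_Hm1p r)\<^sup>2"
proof -
  let ?R = "(norm_Hm1p r)\<^sup>2"
  have "energy e / 2 \<le> ?R / (2 * \<alpha>)"
  proof (rule field_le_epsilon)
    fix d :: real assume d: "0 < d"
    obtain F where F: "finite F" "cmod (r e - (\<Sum>k\<in>F. cnj (fourier_coeff e k) * r (phi k))) \<le> d"
      using Hm1p_expansion[OF rH e d] by blast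
    let ?W = "\<lambda>k. 1 + (norm (wave k))\<^sup>2"
    have young: "cmod (cnj (fourier_coeff e k) * r (phi k))
        \<le> ((cmod (r (phi k)))\<^sup>2 / ?W k) / (2 * \<alpha>) + \<alpha> / 2 * (?W k * (cmod (fourier_coeff e k))\<^sup>2)" for k
    proof -
      have y: "x * y \<le> (y\<^sup>2 / W) / (2 * \<alpha>) + \<alpha> / 2 * (W * x\<^sup>2)" if "0 < W" for x y W :: real
      proof -
        have "0 \<le> (y - \<alpha> * W * x)\<^sup>2" by simp
        then have "2 * (\<alpha> * W) * (x * y) \<le> y\<^sup>2 + (\<alpha> * W)\<^sup>2 * x\<^sup>2"
          by (simp add: power2_eq_square algebra_simps)
        then show ?thesis using that \<alpha>_pos
          by (simp add: field_simps power2_eq_square)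
      qed
      show ?thesis unfolding norm_mult complex_mod_cnj by (rule y) (simp add: add_pos_nonneg)
    qed
    have "energy e = Re (r e)" by (simp add: r[OF e] energy_def)
    also have "\<dots> \<le> cmod (r e)" by (rule complex_Re_le_cmod)
    also have "\<dots> \<le> cmod (\<Sum>k\<in>F. cnj (fourier_coeff e k) * r (phi k)) + d"
      using F(2) norm_triangle_sub[of "r e" "\<Sum>k\<in>F. cnj (fourier_coeff e k) * r (phi k)"] by linarith
    also have "cmod (\<Sum>k\<in>F. cnj (fourier_coeff e k) * r (phi k))
        \<le> (\<Sum>k\<in>F. ((cmod (r (phi k)))\<^sup>2 / ?W k) / (2 * \<alpha>) + \<alpha> / 2 * (?W k * (cmod (fourier_coeff e k))\<^sup>2))"
      by (rule order_trans[OF norm_sum sum_mono[OF young]])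
    also have "\<dots> = (\<Sum>k\<in>F. (cmod (r (phi k)))\<^sup>2 / ?W k) / (2 * \<alpha>)
        + \<alpha> / 2 * (\<Sum>k\<in>F. ?W k * (cmod (fourier_coeff e k))\<^sup>2)"
      by (simp only: sum.distrib sum_distrib_left sum_divide_distrib)
    also have "\<dots> \<le> ?R / (2 * \<alpha>) + energy e / 2"
    proof (intro add_mono divide_right_mono)
      show "(\<Sum>k\<in>F. (cmod (r (phi k)))\<^sup>2 / ?W k) \<le> ?R"
        unfolding norm_Hm1p_square dual_coeff_def[symmetric]
        by (rule finite_sum_le_infsum[OF residual_summable[OF e r] F(1)]) auto
      have "\<alpha> * (\<Sum>k\<in>F. ?W k * (cmod (fourier_coeff e k))\<^sup>2) \<le> energy e"
        using mult_left_mono[OF h1_integral_bessel[OF e F(1)] less_imp_le[OF \<alpha>_pos]] energy_coercive[OF e]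
        by (rule order_trans)
      then show "\<alpha> / 2 * (\<Sum>k\<in>F. ?W k * (cmod (fourier_coeff e k))\<^sup>2) \<le> energy e / 2" by simp
    qed (use \<alpha>_pos in simp)
    finally show "energy e / 2 \<le> ?R / (2 * \<alpha>) + d" by simp
  qed
  then show ?thesis using \<alpha>_pos by (simp add: field_simps)
qed

section \<open>Galerkin solutions\<close>

lemma V_sub_zero_energy:
  assumes v: "v \<in> V_sub \<Lambda>" and E: "energy v \<le> 0"
  shows "v = (\<lambda>x. 0)"
proof -
  obtain F c where F: "finite F" "v = (\<lambda>x. \<Sum>k\<in>F. c k * phi k x)"
    using v by (auto simp: V_sub_def)
  have "\<alpha> * h1_integral v \<le> 0" using energy_coercive[OF V_sub_H1p[OF v]] E by simp
  then have "h1_integral v \<le> 0" using \<alpha>_pos by (simp add: mult_le_0_iff)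
  then have "(\<Sum>k\<in>F. (1 + (norm (wave k))\<^sup>2) * (cmod (c k))\<^sup>2) = 0"
    using h1_integral_nonneg[of v] h1_integral_trig[OF F(1), of c] F(2) by simp
  then have "\<forall>k\<in>F. (1 + (norm (wave k))\<^sup>2) * (cmod (c k))\<^sup>2 = 0"
    using F(1) by (subst (asm) sum_nonneg_eq_0_iff) auto
  moreover have "1 + (norm (wave k))\<^sup>2 \<noteq> 0" for k :: "int^'d"
    by (metis add_pos_nonneg less_irrefl zero_le_power2 zero_less_one)
  ultimately have "\<forall>k\<in>F. c k = 0" by auto
  then show ?thesis by (simp add: F(2))
qed

text \<open>Induction over the frequencies. In the step, \<open>phi k\<close> is corrected by an element \<open>p\<close> of the smaller
  space to a function \<open>q\<close> that is \<open>a\<close>-orthogonal to that space. The new solution is the old one plus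
  the multiple of \<open>q\<close> that is fixed by testing with \<open>q\<close>; this is possible since \<open>q\<close> has coefficient
  $1$ at \<open>k\<close>, hence positive energy. The induction hypothesis, which holds for every functional,
  provides both \<open>p\<close> and the old solution.\<close>

lemma galerkin_exists:
  assumes f: "f \<in> Hm1p" and "finite \<Lambda>"
  shows "\<exists>w\<in>V_sub \<Lambda>. \<forall>v\<in>V_sub \<Lambda>. a w v = f v"
  using assms(2,1)
proof (induction \<Lambda> arbitrary: f rule: finite_induct)
  case empty
  have z: "v = (\<lambda>x. 0)" if "v \<in> V_sub {}" for v :: "real^'d \<Rightarrow> complex"
    using that by (auto simp: V_sub_def)
  have "a (\<lambda>x. 0) (\<lambda>x. 0) = 0" using bform_scale_left[OF H1p_phi V_sub_H1p[OF V_sub_zero], of 0 0] by simp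
  moreover have "f (\<lambda>x. 0) = 0" using Hm1p_scale[OF empty H1p_phi, of 0 0] by simp
  ultimately show ?case using V_sub_zero z by metis
next
  case (insert k \<Lambda>)
  let ?V = "V_sub (insert k \<Lambda>)"
  have sub: "V_sub \<Lambda> \<subseteq> ?V" by (rule V_sub_mono) auto
  have pk: "phi k \<in> ?V" by (rule V_sub_phi) simp
  \<comment> \<open>the functional $v \mapsto - a(\phi_k, v)$ as a residual, so that its boundedness is already known\<close>
  have "residual \<nu> \<sigma> (\<lambda>v. 0) (phi k) \<in> Hm1p"
    by (rule residual_Hm1p[OF _ pk]) (auto simp: Hm1p_def intro: exI[of _ 0])
  from insert.IH[OF this] obtain p where p: "p \<in> V_sub \<Lambda>" "\<And>v. v \<in> V_sub \<Lambda> \<Longrightarrow> a p v = - a (phi k) v"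
    by (auto simp: residual_def L_op_def)
  obtain w where w: "w \<in> V_sub \<Lambda>" "\<And>v. v \<in> V_sub \<Lambda> \<Longrightarrow> a w v = f v"
    using insert.IH[OF insert.prems] by blast
  define q where "q = (\<lambda>x. p x + phi k x)"
  have qV: "q \<in> ?V" unfolding q_def using sub p(1) by (intro V_sub_add pk) auto
  note H = V_sub_H1p[OF qV] V_sub_H1p[OF p(1)] V_sub_H1p[OF w(1)]
  have q0: "a q v = 0" if "v \<in> V_sub \<Lambda>" for v
    using p(2)[OF that] bform_add_left[OF H(2) H1p_phi V_sub_H1p[OF that]] by (simp add: q_def)
  have q0': "a v q = 0" if "v \<in> V_sub \<Lambda>" for v
    using q0[OF that] by (subst bform_cnj) simp
  have "fourier_coeff p k = 0"
  proof -
    obtain F c where "finite F" "F \<subseteq> \<Lambda>" "p = (\<lambda>x. \<Sum>k\<in>F. c k * phi k x)"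
      using p(1) by (auto simp: V_sub_def)
    then show ?thesis using insert.hyps by (auto simp: fourier_coeff_trig)
  qed
  then have "fourier_coeff q k = 1"
    using fourier_coeff_add[OF H1p_L2[OF H(2)] L2_continuous[OF continuous_phi], of k k]
    by (simp add: q_def fourier_coeff_phi)
  then have "q \<noteq> (\<lambda>x. 0)" by (auto simp: fourier_coeff_def)
  then have "0 < energy q" using V_sub_zero_energy[OF qV] by force
  then have qq: "a q q \<noteq> 0" by (simp add: bform_self)
  define s where "s = (f q - a w q) / a q q"
  let ?u = "\<lambda>x. w x + s * q x"
  have uV: "?u \<in> ?V" using w(1) sub by (intro V_sub_add V_sub_scale qV) auto
  have au: "a ?u v = a w v + s * a q v" if "v \<in> H1p" for v
    by (simp add: bform_add_left[OF H(3) H1p_scale[OF H(1)] that] bform_scale_left[OF H(1) that])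
  have "a ?u v = f v" if v: "v \<in> ?V" for v
  proof -
    obtain y c where y: "y \<in> V_sub \<Lambda>" "v = (\<lambda>x. y x + c * phi k x)"
      using V_sub_insert[OF v] by blast
    \<comment> \<open>rewriting \<open>v\<close> in terms of \<open>q\<close> instead of \<open>phi k\<close> makes the two components orthogonal\<close>
    define y' where "y' = (\<lambda>x. y x - c * p x)"
    have y': "y' \<in> V_sub \<Lambda>" unfolding y'_def by (intro V_sub_diff V_sub_scale y p)
    have v': "v = (\<lambda>x. y' x + c * q x)" by (simp add: y y'_def q_def algebra_simps)
    note yH = V_sub_H1p[OF y'] and uH = V_sub_H1p[OF uV]
    have "a ?u v = a ?u y' + cnj c * a ?u q"
      unfolding v' by (simp add: bform_add_right[OF yH H1p_scale[OF H(1)] uH] bform_scale_right[OF H(1) uH])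
    also have "a ?u y' = f y'" by (simp add: au[OF yH] q0[OF y'] w(2)[OF y'])
    also have "a ?u q = f q" unfolding au[OF H(1)] using qq by (simp add: s_def)
    also have "f y' + cnj c * f q = f v"
      unfolding v' by (simp add: Hm1p_add[OF insert.prems yH H1p_scale[OF H(1)]] Hm1p_scale[OF insert.prems H(1)])
    finally show ?thesis .
  qed
  then show ?case using uV by blast
qed

lemma galerkin_solution:
  assumes f: "f \<in> Hm1p" and \<Lambda>: "finite \<Lambda>"
  shows "galerkin \<nu> \<sigma> f \<Lambda> \<in> V_sub \<Lambda>" "\<And>v. v \<in> V_sub \<Lambda> \<Longrightarrow> a (galerkin \<nu> \<sigma> f \<Lambda>) v = f v"
proof -
  have "\<exists>!w. w \<in> V_sub \<Lambda> \<and> (\<forall>v\<in>V_sub \<Lambda>. a w v = f v)"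
  proof (rule ex_ex1I)
    show "\<exists>w. w \<in> V_sub \<Lambda> \<and> (\<forall>v\<in>V_sub \<Lambda>. a w v = f v)"
      using galerkin_exists[OF assms] by blast
    fix w y assume w: "w \<in> V_sub \<Lambda> \<and> (\<forall>v\<in>V_sub \<Lambda>. a w v = f v)"
      and y: "y \<in> V_sub \<Lambda> \<and> (\<forall>v\<in>V_sub \<Lambda>. a y v = f v)"
    have d: "(\<lambda>x. w x - y x) \<in> V_sub \<Lambda>" using w y by (intro V_sub_diff) auto
    have "energy (\<lambda>x. w x - y x) = 0"
      using w y d bform_diff_left[OF V_sub_H1p V_sub_H1p V_sub_H1p[OF d], of w \<Lambda> y \<Lambda>]
      by (simp add: energy_def)
    then have "(\<lambda>x. w x - y x) = (\<lambda>x. 0)" by (intro V_sub_zero_energy[OF d]) simp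
    then show "w = y" by (metis eq_iff_diff_eq_0 ext)
  qed
  from theI'[OF this] show "galerkin \<nu> \<sigma> f \<Lambda> \<in> V_sub \<Lambda>"
    "\<And>v. v \<in> V_sub \<Lambda> \<Longrightarrow> a (galerkin \<nu> \<sigma> f \<Lambda>) v = f v"
    unfolding galerkin_def by blast+
qed

section \<open>Contraction in one step\<close>

text \<open>With $e = u - w$ and $d = w' - w$, Galerkin orthogonality splits the energy of $e$ into those of
  $u - w'$ and of $d$. So it suffices that $d$ carries the fraction $\theta^2 \alpha / \beta$ of the
  energy of $e$. On the frequencies in $D$ the functional $a(d, \cdot)$ coincides with the residual $r$,
  hence $\beta\, a(d, d) \ge \|P_D r\|^2 \ge \theta^2 \|r\|^2 \ge \theta^2 \alpha\, a(e, e)$.\<close>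

lemma galerkin_step_contraction:
  assumes f: "f \<in> Hm1p" and u: "u \<in> H1p" "\<And>v. v \<in> H1p \<Longrightarrow> a u v = f v"
    and w: "w \<in> V_sub \<Lambda>" and r: "r \<in> Hm1p" "\<And>v. v \<in> H1p \<Longrightarrow> r v = f v - a w v"
    and \<theta>: "0 \<le> \<theta>"
    and D: "finite D" "\<theta> * norm_Hm1p r \<le> norm_Hm1p (proj D r)"
    and w': "w' \<in> V_sub (\<Lambda> \<union> D)" "\<And>v. v \<in> V_sub (\<Lambda> \<union> D) \<Longrightarrow> a w' v = f v"
  shows "energy (\<lambda>x. u x - w' x) \<le> (1 - \<alpha> / \<beta> * \<theta>\<^sup>2) * energy (\<lambda>x. u x - w x)"
proof -
  let ?V = "V_sub (\<Lambda> \<union> D)"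
  have wV: "w \<in> ?V" using w V_sub_mono[of \<Lambda> "\<Lambda> \<union> D"] by blast
  define e where "e = (\<lambda>x. u x - w x)"
  define e' where "e' = (\<lambda>x. u x - w' x)"
  define d where "d = (\<lambda>x. w' x - w x)"
  have dV: "d \<in> ?V" unfolding d_def by (intro V_sub_diff w' wV)
  note H = V_sub_H1p[OF wV] V_sub_H1p[OF w'(1)] V_sub_H1p[OF dV]
  have eH: "e \<in> H1p" "e' \<in> H1p" unfolding e_def e'_def by (intro H1p_diff u H)+
  have re: "r v = a e v" if "v \<in> H1p" for v
    unfolding e_def by (simp add: bform_diff_left[OF u(1) H(1) that] u(2)[OF that] r(2)[OF that])
  have orth: "a e' v = 0" if "v \<in> ?V" for v
    using V_sub_H1p[OF that] that
    unfolding e'_def by (simp add: bform_diff_left[OF u(1) H(2)] u(2) w'(2))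
  have split: "e = (\<lambda>x. e' x + d x)" by (simp add: e_def e'_def d_def)
  have pyth: "energy e = energy e' + energy d"
    unfolding split by (simp add: energy_add[OF eH(2) H(3)] orth[OF dV])
  have dphi: "a d (phi k) = r (phi k)" if "k \<in> D" for k
  proof -
    have k: "phi k \<in> ?V" by (rule V_sub_phi) (use that in auto)
    have "a e (phi k) = a e' (phi k) + a d (phi k)"
      unfolding split by (rule bform_add_left[OF eH(2) H(3) H1p_phi])
    then show ?thesis using orth[OF k] re[OF H1p_phi] by simp
  qed
  have "\<theta>\<^sup>2 * (\<alpha> * energy e) \<le> \<theta>\<^sup>2 * (norm_Hm1p r)\<^sup>2"
    by (intro mult_left_mono energy_le_residual[OF eH(1) r(1) re]) auto
  also have "\<dots> \<le> (norm_Hm1p (proj D r))\<^sup>2"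
    unfolding power_mult_distrib[symmetric]
    by (intro power_mono D mult_nonneg_nonneg \<theta> norm_Hm1p_nonneg)
  also have "\<dots> = (\<Sum>k\<in>D. (cmod (a d (phi k)))\<^sup>2 / (1 + (norm (wave k))\<^sup>2))"
    unfolding norm_Hm1p_proj[OF D(1)] by (intro sum.cong) (auto simp: dphi)
  also have "\<dots> \<le> \<beta> * energy d" by (rule dual_sum_le_energy[OF H(3) D(1)])
  finally have "\<theta>\<^sup>2 * (\<alpha> * energy e) / \<beta> \<le> energy d"
    using \<beta>_pos by (simp add: pos_divide_le_eq mult.commute)
  then have "energy e' \<le> (1 - \<alpha> / \<beta> * \<theta>\<^sup>2) * energy e"
    using pyth by (simp add: algebra_simps)
  then show ?thesis by (simp add: e_def e'_def)
qed

end

section \<open>The sequence generated by the algorithm\<close>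

locale adfour_run = elliptic_coefficients \<nu> \<sigma> \<alpha> \<beta>
  for \<nu> \<sigma> :: "real^'d \<Rightarrow> real" and \<alpha> \<beta> :: real +
  fixes f :: "'d functional" and u :: "real^'d \<Rightarrow> complex" and D :: "'d doerfler" and \<theta> :: real
  assumes f: "f \<in> Hm1p" and sol: "is_solution \<nu> \<sigma> f u" and D: "doerfler_procedure D"
    and \<theta>: "0 < \<theta>" "\<theta> < 1"
begin

definition Lam where "Lam n = fst (adfour_iter D \<nu> \<sigma> f \<theta> n)"
definition U where "U n = fst (snd (adfour_iter D \<nu> \<sigma> f \<theta> n))"
definition R where "R n = snd (snd (adfour_iter D \<nu> \<sigma> f \<theta> n))"
definition error_energy where "error_energy n = energy (\<lambda>x. u x - U n x)"

lemma iter_0: "Lam 0 = {}" "U 0 = (\<lambda>x. 0)" "R 0 = f"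
  by (simp_all add: Lam_def U_def R_def)

lemma iter_Suc:
  "Lam (Suc n) = Lam n \<union> D (R n) \<theta>"
  "U (Suc n) = galerkin \<nu> \<sigma> f (Lam (Suc n))"
  "R (Suc n) = residual \<nu> \<sigma> f (U (Suc n))"
  by (simp_all add: Lam_def U_def R_def case_prod_beta Let_def)

lemma u_H1p: "u \<in> H1p" and u_sol: "v \<in> H1p \<Longrightarrow> a u v = f v"
  using sol by (auto simp: is_solution_def)

lemma D_set:
  assumes "r \<in> Hm1p"
  shows "finite (D r \<theta>)" "\<theta> * norm_Hm1p r \<le> norm_Hm1p (proj (D r \<theta>) r)"
  using D \<theta> assms by (auto simp: doerfler_procedure_def is_doerfler_set_def)

text \<open>At the start the residual is \<open>f\<close> itself, which agrees with the residual of the zero function on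
  \<open>H1p\<close>; outside \<open>H1p\<close> its values are arbitrary. This is why the last conjunct is restricted to \<open>H1p\<close>.\<close>

lemma iter_invariant: "finite (Lam n) \<and> U n \<in> V_sub (Lam n) \<and> R n \<in> Hm1p \<and> (\<forall>v\<in>H1p. R n v = f v - a (U n) v)"
proof (induction n)
  case 0
  have "a (\<lambda>x. 0) v = 0" if "v \<in> H1p" for v
    using bform_scale_left[OF H1p_phi that, of 0 0] by simp
  then show ?case by (simp add: iter_0 V_sub_zero f)
next
  case (Suc n)
  then have fin: "finite (Lam (Suc n))" using D_set[of "R n"] by (simp add: iter_Suc)
  have "U (Suc n) \<in> V_sub (Lam (Suc n))"
    unfolding iter_Suc(2) by (rule galerkin_solution(1)[OF f fin])
  moreover from residual_Hm1p[OF f this] have "R (Suc n) \<in> Hm1p"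
    by (simp only: iter_Suc(3))
  moreover have "R (Suc n) v = f v - a (U (Suc n)) v" for v
    by (simp only: iter_Suc(3) residual_def L_op_def)
  ultimately show ?case using fin by blast
qed

lemma U_H1p: "U n \<in> H1p"
  using iter_invariant[of n] V_sub_H1p by blast

lemma err_H1p: "(\<lambda>x. u x - U n x) \<in> H1p"
  by (intro H1p_diff u_H1p U_H1p)

lemma residual_err: "v \<in> H1p \<Longrightarrow> R n v = a (\<lambda>x. u x - U n x) v"
  using iter_invariant[of n] by (simp add: bform_diff_left[OF u_H1p U_H1p] u_sol)

lemma err_nonneg: "0 \<le> error_energy n"
  unfolding error_energy_def by (rule energy_nonneg[OF err_H1p])

lemma err_contraction: "error_energy (Suc n) \<le> (1 - \<alpha> / \<beta> * \<theta>\<^sup>2) * error_energy n"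
  unfolding error_energy_def
proof (rule galerkin_step_contraction[OF f u_H1p u_sol])
  show "U n \<in> V_sub (Lam n)" "R n \<in> Hm1p" "\<And>v. v \<in> H1p \<Longrightarrow> R n v = f v - a (U n) v" "0 \<le> \<theta>"
    using iter_invariant[of n] \<theta> by auto
  then show "finite (D (R n) \<theta>)" "\<theta> * norm_Hm1p (R n) \<le> norm_Hm1p (proj (D (R n) \<theta>) (R n))"
    using D_set by auto
  have "finite (Lam (Suc n))" using iter_invariant by blast
  from galerkin_solution[OF f this]
  show "U (Suc n) \<in> V_sub (Lam n \<union> D (R n) \<theta>)"
    "\<And>v. v \<in> V_sub (Lam n \<union> D (R n) \<theta>) \<Longrightarrow> a (U (Suc n)) v = f v"
    by (simp_all only: iter_Suc(1,2))
qed

lemma rate_bounds: "0 < 1 - \<alpha> / \<beta> * \<theta>\<^sup>2" "1 - \<alpha> / \<beta> * \<theta>\<^sup>2 < 1"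
proof -
  have "\<alpha> \<le> \<beta>" using \<alpha>_\<nu> \<nu>_\<beta> order_trans by blast
  then have "\<alpha> / \<beta> \<le> 1" using \<beta>_pos by simp
  moreover have "\<theta>\<^sup>2 < 1" using \<theta> by (simp add: power_less_one_iff)
  ultimately have "\<alpha> / \<beta> * \<theta>\<^sup>2 < 1"
    using mult_right_mono[of "\<alpha> / \<beta>" 1 "\<theta>\<^sup>2"] by simp
  then show "0 < 1 - \<alpha> / \<beta> * \<theta>\<^sup>2" by simp
  show "1 - \<alpha> / \<beta> * \<theta>\<^sup>2 < 1" using \<alpha>_pos \<beta>_pos \<theta> by simp
qed

text \<open>The iteration is considered here as if it never stopped; the stopping test only truncates it.\<close>

lemma err_tendsto: "error_energy \<longlonglongrightarrow> 0"
proof -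
  let ?q = "1 - \<alpha> / \<beta> * \<theta>\<^sup>2"
  have "error_energy n \<le> ?q ^ n * error_energy 0" for n
  proof (induction n)
    case (Suc n)
    have "error_energy (Suc n) \<le> ?q * error_energy n" by (rule err_contraction)
    also have "\<dots> \<le> ?q * (?q ^ n * error_energy 0)"
      by (rule mult_left_mono[OF Suc less_imp_le[OF rate_bounds(1)]])
    finally show ?case by simp
  qed simp
  moreover have "(\<lambda>n. ?q ^ n * error_energy 0) \<longlonglongrightarrow> 0 * error_energy 0"
    by (rule tendsto_mult[OF LIMSEQ_realpow_zero[OF less_imp_le[OF rate_bounds(1)] rate_bounds(2)] tendsto_const])
  ultimately show ?thesis
    by (intro tendsto_zero_squeeze[OF err_nonneg]) simp_all
qed

lemma residual_tendsto: "(\<lambda>n. norm_Hm1p (R n)) \<longlonglongrightarrow> 0"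
proof -
  have "(norm_Hm1p (R n))\<^sup>2 \<le> \<beta> * error_energy n" for n
    unfolding error_energy_def by (rule residual_le_energy[OF err_H1p residual_err])
  moreover have "(\<lambda>n. \<beta> * error_energy n) \<longlonglongrightarrow> \<beta> * 0" by (intro tendsto_intros err_tendsto)
  ultimately have "(\<lambda>n. (norm_Hm1p (R n))\<^sup>2) \<longlonglongrightarrow> 0"
    by (intro tendsto_zero_squeeze[of "\<lambda>n. (norm_Hm1p (R n))\<^sup>2" "\<lambda>n. \<beta> * error_energy n"]) simp_all
  from tendsto_real_sqrt[OF this] show ?thesis by (simp add: norm_Hm1p_nonneg)
qed

lemma adfour_terminates:
  assumes "0 < tol"
  shows "adfour_steps D \<nu> \<sigma> f \<theta> tol < \<infinity>"
proof -
  have "\<forall>\<^sub>F n in sequentially. norm_Hm1p (R n) < tol"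
    using residual_tendsto assms by (rule order_tendstoD)
  then obtain N where "\<And>n. N \<le> n \<Longrightarrow> norm_Hm1p (R n) < tol"
    unfolding eventually_sequentially by blast
  then have "norm_Hm1p (R (Suc N)) \<le> tol" by (simp add: less_imp_le)
  then have "adfour_steps D \<nu> \<sigma> f \<theta> tol \<le> enat (Suc N)"
    unfolding adfour_steps_def R_def by (intro Inf_lower CollectI exI[of _ N]) simp
  then show ?thesis by (rule le_less_trans) simp
qed

lemma adfour_u_eq:
  assumes "enat n \<le> adfour_steps D \<nu> \<sigma> f \<theta> tol"
  shows "adfour_u D \<nu> \<sigma> f \<theta> tol n = U n"
  using assms by (simp add: adfour_u_def U_def min_absorb1)

lemma norm_H1p_err_le: "norm_H1p (\<lambda>x. u x - U n x) \<le> sqrt (error_energy n / \<alpha>)"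
  using norm_H1p_le_energy[OF err_H1p[of n]] \<alpha>_pos
  by (intro real_le_rsqrt) (simp add: error_energy_def pos_le_divide_eq mult.commute)

text \<open>With tolerance zero the iteration may still stop, but only at a step whose residual vanishes. Then
  the error vanishes as well, so the constant continuation of the sequence obeys the same bound as
  the iteration that does not stop.\<close>

lemma adfour_converges: "tendsto_H1p (adfour_u D \<nu> \<sigma> f \<theta> 0) u"
proof -
  let ?u = "adfour_u D \<nu> \<sigma> f \<theta> 0" and ?N = "adfour_steps D \<nu> \<sigma> f \<theta> 0"
  have H: "?u n \<in> H1p" for n
    using U_H1p by (simp add: adfour_u_def U_def)
  have le: "norm_H1p (\<lambda>x. u x - ?u n x) \<le> sqrt (error_energy n / \<alpha>)" for n
  proof (cases "enat n \<le> ?N")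
    case True
    then show ?thesis using norm_H1p_err_le[of n] by (simp add: adfour_u_eq)
  next
    case False
    then have fin: "?N < enat n" by simp
    then obtain m where m: "?N = enat m" by (cases ?N) auto
    have "?N \<in> {enat (Suc n) | n. norm_Hm1p (R (Suc n)) \<le> 0}"
    proof -
      let ?A = "{enat (Suc n) | n. norm_Hm1p (R (Suc n)) \<le> 0}"
      have N: "?N = Inf ?A" by (simp add: adfour_steps_def R_def)
      have "?A \<noteq> {}"
      proof
        assume "?A = {}"
        then have "?N = \<infinity>" unfolding N by (simp only: Inf_enat_def if_True simp_thms)
        then show False using m by simp
      qed
      then obtain y where "y \<in> ?A" by blast
      then have "(LEAST y. y \<in> ?A) \<in> ?A" by (rule LeastI)
      then show ?thesis using N \<open>?A \<noteq> {}\<close> by (simp add: Inf_enat_def)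
    qed
    then have "norm_Hm1p (R m) \<le> 0" using m by auto
    then have "norm_Hm1p (R m) = 0" using norm_Hm1p_nonneg[of "R m"] by simp
    moreover have "\<alpha> * error_energy m \<le> (norm_Hm1p (R m))\<^sup>2"
      unfolding error_energy_def using iter_invariant[of m]
      by (intro energy_le_residual err_H1p residual_err) auto
    ultimately have "error_energy m = 0" using \<alpha>_pos err_nonneg[of m] by (simp add: mult_le_0_iff)
    moreover have "?u n = U m" using fin m by (simp add: adfour_u_def U_def min_absorb2)
    ultimately have "norm_H1p (\<lambda>x. u x - ?u n x) \<le> 0" using norm_H1p_err_le[of m] by simp
    also have "\<dots> \<le> sqrt (error_energy n / \<alpha>)" using err_nonneg[of n] \<alpha>_pos by simp
    finally show ?thesis .
  qed
  have "(\<lambda>n. sqrt (error_energy n / \<alpha>)) \<longlonglongrightarrow> sqrt (0 / \<alpha>)"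
    using \<alpha>_pos by (intro tendsto_intros err_tendsto) simp
  then have "(\<lambda>n. norm_H1p (\<lambda>x. u x - ?u n x)) \<longlonglongrightarrow> 0"
    by (intro tendsto_zero_squeeze[OF norm_H1p_nonneg le]) simp
  then show ?thesis using H u_H1p by (simp add: tendsto_H1p_def)
qed

lemma energy_norm_contraction:
  "energy_norm \<nu> \<sigma> (\<lambda>x. u x - U (Suc n) x)
    \<le> sqrt (1 - \<alpha> / \<beta> * \<theta>\<^sup>2) * energy_norm \<nu> \<sigma> (\<lambda>x. u x - U n x)"
  using real_sqrt_le_mono[OF err_contraction[of n]]
  by (simp add: error_energy_def energy_norm_def energy_def real_sqrt_mult)

end

theorem theorem3p1:
  fixes \<nu> \<sigma> :: "real^'d \<Rightarrow> real"
    and \<nu>_lo \<nu>_up \<sigma>_lo \<sigma>_up \<alpha>_lo \<alpha>_up \<theta> tol \<rho> :: real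
    and f :: "'d functional"
    and u :: "real^'d \<Rightarrow> complex"
    and D :: "'d doerfler"
  assumes "C1 \<nu>" "periodic \<nu>" "C1 \<sigma>" "periodic \<sigma>"
    and "0 < \<nu>_lo" "\<And>x. \<nu>_lo \<le> \<nu> x" "\<And>x. \<nu> x \<le> \<nu>_up"
    and "0 < \<sigma>_lo" "\<And>x. \<sigma>_lo \<le> \<sigma> x" "\<And>x. \<sigma> x \<le> \<sigma>_up"
    and "\<alpha>_lo = min \<nu>_lo \<sigma>_lo" "\<alpha>_up = max \<nu>_up \<sigma>_up"
    and "f \<in> Hm1p"
    and "is_solution \<nu> \<sigma> f u"
    and "doerfler_procedure D"
    and "0 < \<theta>" "\<theta> < 1" "0 \<le> tol" "tol < 1"
    and "\<rho> = sqrt (1 - \<alpha>_lo / \<alpha>_up * \<theta>\<^sup>2)"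
  shows "0 < \<rho> \<and> \<rho> < 1
    \<and> (\<forall>n. enat n < adfour_steps D \<nu> \<sigma> f \<theta> tol \<longrightarrow>
          energy_norm \<nu> \<sigma> (\<lambda>x. u x - adfour_u D \<nu> \<sigma> f \<theta> tol (Suc n) x)
            \<le> \<rho> * energy_norm \<nu> \<sigma> (\<lambda>x. u x - adfour_u D \<nu> \<sigma> f \<theta> tol n x))
    \<and> (0 < tol \<longrightarrow> adfour_steps D \<nu> \<sigma> f \<theta> tol < \<infinity>)
    \<and> (tol = 0 \<longrightarrow> tendsto_H1p (adfour_u D \<nu> \<sigma> f \<theta> tol) u)"
proof -
  interpret adfour_run \<nu> \<sigma> \<alpha>_lo \<alpha>_up f u D \<theta>
    by unfold_locales (use assms in \<open>auto intro: C1_continuous simp: min_le_iff_disj le_max_iff_disj\<close>)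
  have "0 < \<rho>" "\<rho> < 1" using rate_bounds assms(20) by auto
  moreover have "energy_norm \<nu> \<sigma> (\<lambda>x. u x - adfour_u D \<nu> \<sigma> f \<theta> tol (Suc n) x)
      \<le> \<rho> * energy_norm \<nu> \<sigma> (\<lambda>x. u x - adfour_u D \<nu> \<sigma> f \<theta> tol n x)"
    if n: "enat n < adfour_steps D \<nu> \<sigma> f \<theta> tol" for n
  proof -
    have "enat (Suc n) \<le> adfour_steps D \<nu> \<sigma> f \<theta> tol"
      using n by (simp add: Suc_ile_eq)
    then show ?thesis
      using energy_norm_contraction[of n] n assms(20) by (simp add: adfour_u_eq)
  qed
  ultimately show ?thesis using adfour_terminates adfour_converges by auto
qed

end
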